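(* Let $D$ be a v-adequate virtual link diagram obtained from an adequate classical link diagram $D'$ (that is, $D$ is obtained from $D'$ by replacing exactly one real crossing of $D'$ with a virtual crossing). Then $D$ does not represent any classical link.
   Context: Virtual link diagrams are in the sense of Kauffman (generic immersed closed curves in the plane with real crossings and virtual crossings); two are equivalent if related by a finite sequence of Reidemeister moves and virtual Reidemeister moves, and a virtual link is an equivalence class. A classical diagram is one without virtual crossings; a diagram represents a classical link if it is equivalent to a classical diagram. At a real crossing whose over-strand runs from bottom-left to top-right and whose under-strand runs from top-left to bottom-right, the A-splice replaces the crossing by two vertical strands $)\,($ (one joining the two left endpoints, the other the two right endpoints), and the B-splice replaces it by two horizontal strands (one joining the two top endpoints, the other the two bottom endpoints). A state $s$ of a diagram $D$ is a map from the set of real crossings of $D$ to $\{\mathrm{A},\mathrm{B}\}$; $D(s)$ is the diagram obtained by performing the $s(p)$-splice at each real crossing $p$, and $\sharp D(s)$ is its number of components (closed curves). $s_A$ (resp. $s_B$) is the state sending every real crossing to A (resp. B). A diagram $D$ is adequate if $\sharp D(s_A)> \sharp D(s_A(1))$ for every state $s_A(1)$ that sends exactly one real crossing to B and all others to A, and $\sharp D(s_B)>\sharp D(s_B(1))$ for every state $s_B(1)$ that sends exactly one real crossing to A and all others to B. A v-adequate diagram is a diagram obtained from an adequate diagram by virtualizing one real crossing, i.e. replacing that real crossing with a virtual crossing. *)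

theory Defs
  imports "HOL-Library.Multiset"
begin

section \<open>Diagrams\<close>

text \<open>
  A generic immersed closed plane curve with real and virtual crossings is recorded by a planar
  diagram code: a list of tiles whose ends carry labels, two ends being joined by an edge when they
  carry the same label.  The ends of a crossing are listed counterclockwise.  At a real crossing
  \<open>RealX a b c d\<close> the under-strand is \<open>a\<close>--\<open>c\<close> and the over-strand is \<open>b\<close>--\<open>d\<close>; in the picture with
  the over-strand running from bottom-left to top-right, \<open>a, b, c, d\<close> are the top-left, bottom-left,
  bottom-right and top-right ends.  An \<open>Arc\<close> is a marked point on a strand, with no crossing; it
  allows closed curves without crossings, such as \<open>[Arc a a]\<close>, to be written down.
\<close>

datatype 'l tile =
    RealX 'l 'l 'l 'l
  | VirtX 'l 'l 'l 'l
  | Arc 'l 'l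

type_synonym code = "nat tile list"

fun ends :: "'l tile \<Rightarrow> 'l list" where
  "ends (RealX a b c d) = [a, b, c, d]"
| "ends (VirtX a b c d) = [a, b, c, d]"
| "ends (Arc a b) = [a, b]"

definition labels :: "code \<Rightarrow> nat set" where
  "labels D = (\<Union>t\<in>set D. set_tile t)"

definition well_formed :: "code \<Rightarrow> bool" where
  "well_formed D \<longleftrightarrow> (\<forall>l\<in>labels D. count_list (concat (map ends D)) l = 2)"

definition num_classes :: "'a set \<Rightarrow> ('a \<times> 'a) set \<Rightarrow> nat" where
  "num_classes X r = card (X // (r \<union> r\<inverse>)\<^sup>*)"

text \<open>
  Planarity is Euler's formula for the underlying combinatorial map, whose vertices are the tiles
  and whose edges are the labels.  A dart \<open>(i, k)\<close> is the \<open>k\<close>-th end of the \<open>i\<close>-th tile; the faces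
  are the orbits of darts under going to the other end of the edge and then turning to the next end
  of the tile found there.  Each connected component contributes at most 2 to
  vertices - edges + faces, with equality exactly for genus 0, so the formula says that every
  component has genus 0.
\<close>

definition darts :: "code \<Rightarrow> (nat \<times> nat) set" where
  "darts D = {(i, k). i < length D \<and> k < length (ends (D ! i))}"

definition face_step :: "code \<Rightarrow> ((nat \<times> nat) \<times> (nat \<times> nat)) set" where
  "face_step D = {((i, k), (j, Suc m mod length (ends (D ! j)))) | i k j m.
     (i, k) \<in> darts D \<and> (j, m) \<in> darts D \<and> (i, k) \<noteq> (j, m) \<and>
     ends (D ! i) ! k = ends (D ! j) ! m}"

definition num_faces :: "code \<Rightarrow> nat" where
  "num_faces D = num_classes (darts D) (face_step D)"

definition num_connected_parts :: "code \<Rightarrow> nat" where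
  "num_connected_parts D = num_classes (labels D) (\<Union>t\<in>set D. set_tile t \<times> set_tile t)"

definition planar :: "code \<Rightarrow> bool" where
  "planar D \<longleftrightarrow> length D + num_faces D = card (labels D) + 2 * num_connected_parts D"

definition virtual_diagram :: "code \<Rightarrow> bool" where
  "virtual_diagram D \<longleftrightarrow> well_formed D \<and> planar D"

definition classical_diagram :: "code \<Rightarrow> bool" where
  "classical_diagram D \<longleftrightarrow> virtual_diagram D \<and> (\<forall>a b c d. VirtX a b c d \<notin> set D)"


section \<open>Moves\<close>

text \<open>
  Different codes of the same diagram: reordering the tiles, renaming the labels, reading the ends
  of a tile from another starting point, and inserting or deleting marked points.
\<close>

inductive recoding :: "code \<Rightarrow> code \<Rightarrow> bool" where
  reorder: "mset D = mset E \<Longrightarrow> recoding D E"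
| rename: "inj_on f (labels D) \<Longrightarrow> recoding D (map (map_tile f) D)"
| turn_real: "i < length D \<Longrightarrow> D ! i = RealX a b c d \<Longrightarrow> recoding D (D[i := RealX c d a b])"
| turn_virt: "i < length D \<Longrightarrow> D ! i = VirtX a b c d \<Longrightarrow> recoding D (D[i := VirtX b c d a])"
| turn_arc: "i < length D \<Longrightarrow> D ! i = Arc a b \<Longrightarrow> recoding D (D[i := Arc b a])"
| unmark: "a \<noteq> b \<Longrightarrow> recoding (Arc a b # D) (map (map_tile (id(b := a))) D)"

text \<open>
  The local moves replace the part of a diagram inside a disc.  In R1 and V1 the boundary ends are
  \<open>p, q\<close>; in R2 and V2 they are \<open>p, r, s, q\<close> counterclockwise; in the three-strand moves they are
  \<open>p1, \<dots>, p6\<close> counterclockwise, with strands \<open>p1\<close>--\<open>p4\<close>, \<open>p2\<close>--\<open>p5\<close> and \<open>p3\<close>--\<open>p6\<close>, and the strand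
  \<open>p1\<close>--\<open>p4\<close> is moved across the crossing of the other two.  The remaining labels are inside the
  disc.  Variants that differ by a rotation of the disc or by exchanging the two sides of a move are
  not listed again.  In R3 the moved strand is the lowest one, and the crossing of the other two may
  be of either kind; turning the disc so that another strand is the lowest one gives all six height
  orders of the strands.
\<close>

inductive reidemeister :: "nat tile multiset \<Rightarrow> nat tile multiset \<Rightarrow> bool" where
  R1: "reidemeister {#RealX x x p q#} {#Arc p q#}"
| R1': "reidemeister {#RealX p x x q#} {#Arc p q#}"
| R2: "reidemeister {#RealX p r x y, RealX x s q y#} {#Arc p q, Arc r s#}"
| R3: "reidemeister
    {#RealX p1 p2 x y, RealX x p3 p4 z, RealX y z p5 p6#}
    {#RealX x y p4 p5, RealX p1 z x p6, RealX p2 p3 y z#}"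
| R3': "reidemeister
    {#RealX p1 p2 x y, RealX x p3 p4 z, RealX z p5 p6 y#}
    {#RealX x y p4 p5, RealX p1 z x p6, RealX p3 y z p2#}"

inductive virtual_reidemeister :: "nat tile multiset \<Rightarrow> nat tile multiset \<Rightarrow> bool" where
  V1: "virtual_reidemeister {#VirtX x x p q#} {#Arc p q#}"
| V2: "virtual_reidemeister {#VirtX p r x y, VirtX x s q y#} {#Arc p q, Arc r s#}"
| V3: "virtual_reidemeister
    {#VirtX p1 p2 x y, VirtX x p3 p4 z, VirtX y z p5 p6#}
    {#VirtX x y p4 p5, VirtX p1 z x p6, VirtX p2 p3 y z#}"
| V4: "virtual_reidemeister
    {#VirtX p1 p2 x y, VirtX x p3 p4 z, RealX y z p5 p6#}
    {#VirtX x y p4 p5, VirtX p1 z x p6, RealX p2 p3 y z#}"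
| V4': "virtual_reidemeister
    {#VirtX p1 p2 x y, VirtX x p3 p4 z, RealX z p5 p6 y#}
    {#VirtX x y p4 p5, VirtX p1 z x p6, RealX p3 y z p2#}"

text \<open>
  In \<open>move\<close>, well-formedness of both codes forces the inner labels of a local move to occur nowhere
  else in the diagram.
\<close>

definition move :: "code \<Rightarrow> code \<Rightarrow> bool" where
  "move D E \<longleftrightarrow> virtual_diagram D \<and> virtual_diagram E \<and>
     (recoding D E \<or>
      (\<exists>M L R. (reidemeister L R \<or> virtual_reidemeister L R) \<and>
         mset D = L + M \<and> mset E = R + M))"

definition equivalent :: "code \<Rightarrow> code \<Rightarrow> bool" where
  "equivalent D E \<longleftrightarrow> equivclp move D E"

definition represents_classical_link :: "code \<Rightarrow> bool" where
  "represents_classical_link D \<longleftrightarrow> (\<exists>E. classical_diagram E \<and> equivalent D E)"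


section \<open>States and adequacy\<close>

fun strands :: "'l tile \<Rightarrow> ('l \<times> 'l) set" where
  "strands (RealX a b c d) = {(a, c), (b, d)}"
| "strands (VirtX a b c d) = {(a, c), (b, d)}"
| "strands (Arc a b) = {(a, b)}"

definition num_components :: "code \<Rightarrow> nat" where
  "num_components D = num_classes (labels D) (\<Union>t\<in>set D. strands t)"

definition real_crossings :: "code \<Rightarrow> nat set" where
  "real_crossings D = {i. i < length D \<and> (\<exists>a b c d. D ! i = RealX a b c d)}"

datatype splice = A | B

text \<open>
  A state is a function on positions in the code; its values outside \<open>real_crossings D\<close> play no role.
\<close>

type_synonym state = "nat \<Rightarrow> splice"

fun splice_tile :: "splice \<Rightarrow> 'l tile \<Rightarrow> 'l tile list" where
  "splice_tile A (RealX a b c d) = [Arc a b, Arc c d]"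
| "splice_tile B (RealX a b c d) = [Arc a d, Arc b c]"
| "splice_tile _ t = [t]"

definition spliced :: "code \<Rightarrow> state \<Rightarrow> code" where
  "spliced D s = concat (map (\<lambda>i. splice_tile (s i) (D ! i)) [0..<length D])"

definition state_A :: state where
  "state_A = (\<lambda>_. A)"

definition state_B :: state where
  "state_B = (\<lambda>_. B)"

definition adequate :: "code \<Rightarrow> bool" where
  "adequate D \<longleftrightarrow> (\<forall>p\<in>real_crossings D.
     num_components (spliced D state_A) > num_components (spliced D (state_A(p := B))) \<and>
     num_components (spliced D state_B) > num_components (spliced D (state_B(p := A))))"

fun virtualize_tile :: "'l tile \<Rightarrow> 'l tile" where
  "virtualize_tile (RealX a b c d) = VirtX a b c d"
| "virtualize_tile t = t"

definition virtualize :: "code \<Rightarrow> nat \<Rightarrow> code" where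
  "virtualize D p = D[p := virtualize_tile (D ! p)]"

definition v_adequate_from :: "code \<Rightarrow> code \<Rightarrow> bool" where
  "v_adequate_from D' D \<longleftrightarrow> virtual_diagram D' \<and> adequate D' \<and>
     (\<exists>p\<in>real_crossings D'. D = virtualize D' p)"

end

theory Submission
  imports Defs "HOL-Computational_Algebra.Formal_Laurent_Series"
begin

text \<open>
  The Kauffman bracket \<open>\<langle>D\<rangle>\<close> is invariant under all moves up to a unit \<open>\<plusminus> A ^ k\<close>, so it makes sense to say
  that all exponents of \<open>\<langle>D\<rangle>\<close> are congruent modulo 4, and this is an invariant of virtual links.
  A classical diagram has this property: its regions are checkerboard colourable, hence all state
  circles are coherently oriented by the colouring, and switching a splice changes the number of
  circles by exactly one.

  Let \<open>D'\<close> be adequate with \<open>n\<close> real crossings, and let \<open>k\<close> and \<open>l\<close> be the numbers of circles of its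
  all-A and all-B states.  By adequacy \<open>\<langle>D'\<rangle>\<close> has extreme exponents \<open>n + 2 k\<close> and \<open>-(n + 2 l)\<close>.  By the
  coherent orientation, among the three ways to join the four ends at a crossing the virtual one gives
  the smaller of the two numbers of circles of the real ones.  So the diagram with one virtualized
  crossing has extreme exponents \<open>(n - 1) + 2 (k - 1)\<close> and \<open>-((n - 1) + 2 (l - 1))\<close>.  The two spans
  differ by 6, so they cannot both be divisible by 4.
\<close>

section \<open>Counting classes of a relation\<close>

text \<open>The number 6 arises as follows: one crossing less takes 1 from either extreme exponent,
  one circle less takes 2, and both losses happen at both ends of the span. Adequacy enters twice.
  Its strictness at the virtualized crossing shows that a circle is lost in both extreme states; at
  the other crossings a non-strict form survives virtualization, and this still keeps the extreme
  coefficients from cancelling. The main obstacle is the checkerboard colouring. Planarity is given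
  as Euler's formula for a code, so there are no regions of a plane to colour, and the colours have
  to be found by counting over the field with two elements. The bracket is taken without a writhe
  factor, since diagrams carry no orientation and a first Reidemeister move merely shifts all
  exponents by 3 or -3. It is normalized so that every circle, the last one included, contributes a
  factor and the empty diagram has value 1. Invariance under the moves is shown in any commutative
  ring from \<open>w A * w B = 1\<close>; Laurent series come in where single coefficients are read
  off.\<close>

definition conn :: "('a \<times> 'a) set \<Rightarrow> ('a \<times> 'a) set" where
  "conn r = (r \<union> r\<inverse>)\<^sup>*"

lemma num_classes_conn: "num_classes X r = card (X // conn r)"
  by (simp add: num_classes_def conn_def)

lemma conn_refl [simp]: "(a, a) \<in> conn r"
  by (simp add: conn_def)

lemma conn_sym: "(a, b) \<in> conn r \<Longrightarrow> (b, a) \<in> conn r"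
  unfolding conn_def by (metis sym_Un_converse sym_rtrancl symD)

lemma conn_trans: "(a, b) \<in> conn r \<Longrightarrow> (b, c) \<in> conn r \<Longrightarrow> (a, c) \<in> conn r"
  unfolding conn_def by (rule rtrancl_trans)

lemma equiv_conn: "equiv UNIV (conn r)"
  by (intro equivI) (auto simp: refl_on_def trans_def intro: conn_sym conn_trans symI)

lemma conn_edge: "(a, b) \<in> r \<Longrightarrow> (a, b) \<in> conn r"
  unfolding conn_def by blast

lemma conn_induct [consumes 1, case_names base step]:
  assumes "(a, b) \<in> conn r" and "P a"
    and "\<And>b c. (a, b) \<in> conn r \<Longrightarrow> (b, c) \<in> r \<or> (c, b) \<in> r \<Longrightarrow> P b \<Longrightarrow> P c"
  shows "P b"
  using assms(1) unfolding conn_def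
  by (induction rule: rtrancl_induct) (use assms(2,3) in \<open>auto simp: conn_def\<close>)

lemma conn_mono: "(a, b) \<in> conn r \<Longrightarrow> r \<subseteq> s \<Longrightarrow> (a, b) \<in> conn s"
  using rtrancl_mono[of "r \<union> r\<inverse>" "s \<union> s\<inverse>"] unfolding conn_def by blast

lemma conn_image_eq: "conn r `` {a} = conn r `` {b} \<longleftrightarrow> (a, b) \<in> conn r"
  using eq_equiv_class_iff[OF equiv_conn, of a b r] by simp

lemma conn_map:
  assumes "(a, b) \<in> conn r" and "\<And>a b. (a, b) \<in> r \<Longrightarrow> (f a, f b) \<in> conn s"
  shows "(f a, f b) \<in> conn s"
  using assms(1)
proof (induction rule: conn_induct)
  case base
  show ?case by simp
next
  case (step b c)
  then have "(f b, f c) \<in> conn s" using assms(2) conn_sym by fast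
  with step show ?case using conn_trans by fast
qed

text \<open>The maps are inverse to each other only up to the relations. This covers contractions,
  which identify points but not classes.\<close>

lemma num_classes_eq_if:
  assumes "f ` X \<subseteq> Y" and "g ` Y \<subseteq> X"
    and "\<And>a b. (a, b) \<in> r \<Longrightarrow> (f a, f b) \<in> conn s"
    and "\<And>a b. (a, b) \<in> s \<Longrightarrow> (g a, g b) \<in> conn r"
    and gf: "\<And>x. x \<in> X \<Longrightarrow> (g (f x), x) \<in> conn r"
    and fg: "\<And>y. y \<in> Y \<Longrightarrow> (f (g y), y) \<in> conn s"
  shows "num_classes X r = num_classes Y s"
proof -
  have f: "(f a, f b) \<in> conn s" if "(a, b) \<in> conn r" for a b
    using conn_map[OF that] assms(3) by blast
  have g: "(g a, g b) \<in> conn r" if "(a, b) \<in> conn s" for a b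
    using conn_map[OF that] assms(4) by blast
  have "inj_on (\<lambda>c. conn s `` (f ` c)) (X // conn r)"
    and "(\<lambda>c. conn s `` (f ` c)) ` (X // conn r) = Y // conn s"
  proof -
    have img: "conn s `` (f ` (conn r `` {x})) = conn s `` {f x}" for x
      using f conn_trans by fastforce
    have "x \<in> X \<Longrightarrow> y \<in> X \<Longrightarrow> (f x, f y) \<in> conn s \<Longrightarrow> (x, y) \<in> conn r" for x y
      by (meson conn_sym conn_trans g gf)
    then show "inj_on (\<lambda>c. conn s `` (f ` c)) (X // conn r)"
      unfolding inj_on_def by (intro ballI impI; elim quotientE; hypsubst; simp only: img conn_image_eq)
    have "conn s `` {y} \<in> (\<lambda>c. conn s `` (f ` c)) ` (X // conn r)" if "y \<in> Y" for y
    proof (rule image_eqI)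
      show "conn s `` {y} = conn s `` (f ` (conn r `` {g y}))"
        using fg[OF that] by (simp add: img conn_image_eq conn_sym)
      show "conn r `` {g y} \<in> X // conn r"
        using that assms(2) by (auto simp: quotient_def)
    qed
    then show "(\<lambda>c. conn s `` (f ` c)) ` (X // conn r) = Y // conn s"
      using assms(1) by (auto simp: img quotientI elim!: quotientE)
  qed
  then have "bij_betw (\<lambda>c. conn s `` (f ` c)) (X // conn r) (Y // conn s)"
    by (simp add: bij_betw_def)
  then show ?thesis
    by (simp add: num_classes_conn bij_betw_same_card)
qed

lemma num_classes_cong:
  assumes "r \<subseteq> conn s" and "s \<subseteq> conn r"
  shows "num_classes X r = num_classes X s"
  by (rule num_classes_eq_if[where f = id and g = id]) (use assms in auto)

lemma num_classes_sym: "r \<union> r\<inverse> = s \<union> s\<inverse> \<Longrightarrow> num_classes X r = num_classes X s"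
  by (simp add: num_classes_def)

lemma num_classes_insert_conn:
  assumes "(u, v) \<in> conn r"
  shows "num_classes X (insert (u, v) r) = num_classes X r"
  by (rule num_classes_cong) (use assms in \<open>auto intro: conn_edge\<close>)

lemma conn_insert:
  assumes "(a, b) \<in> conn (insert (u, v) r)"
  shows "(a, b) \<in> conn r \<or> (a, u) \<in> conn r \<and> (v, b) \<in> conn r
    \<or> (a, v) \<in> conn r \<and> (u, b) \<in> conn r"
  using assms
proof (induction rule: conn_induct)
  case base
  show ?case by simp
next
  case (step b c)
  from step.hyps(2) consider "(b, c) \<in> conn r" | "b = u" "c = v" | "b = v" "c = u"
    by (auto intro: conn_edge conn_sym)
  then show ?case
  proof cases
    case 1
    then show ?thesis using step.IH conn_trans by fast
  next
    case 2
    then show ?thesis using step.IH conn_trans conn_sym by (meson conn_refl)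
  next
    case 3
    then show ?thesis using step.IH conn_trans conn_sym by (meson conn_refl)
  qed
qed

lemma num_classes_insert_not_conn:
  assumes "finite X" and "u \<in> X" and "v \<in> X" and nc: "(u, v) \<notin> conn r"
  shows "Suc (num_classes X (insert (u, v) r)) = num_classes X r"
proof -
  let ?s = "insert (u, v) r"
  have mono: "(a, b) \<in> conn ?s" if "(a, b) \<in> conn r" for a b
    using conn_mono[OF that] by blast
  have uv: "(u, v) \<in> conn ?s" by (simp add: conn_edge)
  \<comment> \<open>The classes of \<open>u\<close> and \<open>v\<close> fuse into one; the classes
    in \<open>?C\<close> stay as they are.\<close>
  let ?C = "X // conn r - {conn r `` {u}, conn r `` {v}}"
  have cls: "conn ?s `` {a} = conn r `` {a}" if "(a, u) \<notin> conn r" "(a, v) \<notin> conn r" for a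
    using that conn_insert[of a _ u v r] mono by blast
  have mem: "(a, u) \<notin> conn r \<and> (a, v) \<notin> conn r" if "a \<in> X" "conn r `` {a} \<in> ?C" for a
    using that by (auto simp: conn_image_eq)
  have un: "X // conn ?s = insert (conn ?s `` {u}) ?C"
  proof (intro equalityI subsetI)
    fix c assume "c \<in> X // conn ?s"
    then obtain a where a: "a \<in> X" "c = conn ?s `` {a}" by (auto simp: quotient_def)
    show "c \<in> insert (conn ?s `` {u}) ?C"
    proof (cases "(a, u) \<in> conn r \<or> (a, v) \<in> conn r")
      case True
      then have "(a, u) \<in> conn ?s" using mono uv conn_sym conn_trans by meson
      then show ?thesis using a by (simp add: conn_image_eq)
    next
      case False
      then have "conn r `` {a} \<in> ?C"
        using a by (auto simp: conn_image_eq quotientI)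
      then show ?thesis using a cls False by simp
    qed
  next
    fix c assume c: "c \<in> insert (conn ?s `` {u}) ?C"
    show "c \<in> X // conn ?s"
    proof (cases "c = conn ?s `` {u}")
      case True
      then show ?thesis using assms(2) by (auto simp: quotient_def)
    next
      case False
      then have "c \<in> ?C" using c by blast
      moreover then obtain a where "a \<in> X" "c = conn r `` {a}" by (auto simp: quotient_def)
      ultimately show ?thesis using cls mem by (metis quotientI)
    qed
  qed
  have fin: "finite (X // conn r)" using assms(1) by (simp add: quotient_def)
  have new: "conn ?s `` {u} \<notin> ?C"
  proof
    assume "conn ?s `` {u} \<in> ?C"
    then obtain a where "a \<in> X" "conn ?s `` {u} = conn r `` {a}" "conn r `` {a} \<in> ?C"
      by (auto simp: quotient_def)
    then show False using mem by (metis Image_singleton_iff conn_refl)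
  qed
  have "card (X // conn ?s) = Suc (card ?C)"
    unfolding un using new fin by simp
  moreover have "conn r `` {u} \<noteq> conn r `` {v}" using nc by (simp add: conn_image_eq)
  moreover have "{conn r `` {u}, conn r `` {v}} \<subseteq> X // conn r"
    using assms by (auto simp: quotient_def)
  then have "card {conn r `` {u}, conn r `` {v}} \<le> card (X // conn r)"
    "card ?C = card (X // conn r) - card {conn r `` {u}, conn r `` {v}}"
    using fin by (auto intro: card_mono card_Diff_subset)
  ultimately show ?thesis by (simp add: num_classes_conn)
qed

lemma num_classes_insert_bounds:
  assumes "finite X" and "u \<in> X" and "v \<in> X"
  shows "num_classes X (insert (u, v) r) \<le> num_classes X r"
    and "num_classes X r \<le> Suc (num_classes X (insert (u, v) r))"
  using num_classes_insert_conn[of u v r X] num_classes_insert_not_conn[OF assms, of r]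
  by (cases "(u, v) \<in> conn r"; linarith)+

text \<open>Sliding \<open>b\<close> along the edge onto \<open>a\<close> keeps the classes. This
  removes a label from the middle of a strand, both for marked points and for labels inside the disc
  of a move.\<close>

lemma num_classes_contract:
  assumes "b \<noteq> a" and "b \<notin> X" and "a \<in> X"
  shows "num_classes (insert b X) (insert (a, b) r) =
    num_classes X (map_prod (id(b := a)) (id(b := a)) ` r)"
proof (rule num_classes_eq_if[where f = "id(b := a)" and g = id])
  let ?s = "insert (a, b) r"
  have ab: "((id(b := a)) x, x) \<in> conn ?s" for x by (simp add: conn_edge)
  show "(id x, id y) \<in> conn ?s"
    if "(x, y) \<in> map_prod (id(b := a)) (id(b := a)) ` r" for x y
  proof -
    from that obtain x' y' where "(x', y') \<in> r" "x = (id(b := a)) x'" "y = (id(b := a)) y'"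
      by auto
    then have "(x', y') \<in> conn ?s" "(x, x') \<in> conn ?s" "(y', y) \<in> conn ?s"
      using ab[of x'] ab[of y'] conn_sym[of y y' ?s] by (auto intro: conn_edge simp del: fun_upd_apply)
    then show ?thesis using conn_trans by (metis id_apply)
  qed
  show "((id(b := a)) x, (id(b := a)) y) \<in> conn (map_prod (id(b := a)) (id(b := a)) ` r)"
    if "(x, y) \<in> insert (a, b) r" for x y
  proof (cases "(x, y) \<in> r")
    case True
    show ?thesis by (rule conn_edge, rule image_eqI[OF _ True]) simp
  next
    case False
    then show ?thesis using that assms(1) by simp
  qed
  show "(id ((id(b := a)) x), x) \<in> conn ?s" for x using ab by simp
qed (use assms in auto)

lemma conn_isolated:
  assumes "(x, y) \<in> conn r" and "x \<notin> Field r"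
  shows "x = y"
  using assms(1) by (induction rule: conn_induct) (use assms(2) in \<open>auto simp: Field_def\<close>)

text \<open>A label that no strand joins to another one stands for a circle split off from the
  rest.\<close>

lemma num_classes_isolated:
  assumes "finite X" and "x \<notin> X" and "x \<notin> Field r"
  shows "num_classes (insert x X) r = Suc (num_classes X r)"
proof -
  have "insert x X // conn r = insert (conn r `` {x}) (X // conn r)"
    by (auto simp: quotient_def)
  moreover have "conn r `` {x} \<notin> X // conn r"
    using assms conn_isolated[of x _ r] by (fastforce simp: quotient_def conn_image_eq)
  moreover have "finite (X // conn r)" using assms(1) by (simp add: quotient_def)
  ultimately show ?thesis by (simp add: num_classes_conn)
qed

lemma num_classes_rename:
  assumes "inj_on f X" and "r \<subseteq> X \<times> X"
  shows "num_classes (f ` X) (map_prod f f ` r) = num_classes X r"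
proof (rule num_classes_eq_if[where f = "inv_into X f" and g = f])
  show "(inv_into X f a, inv_into X f b) \<in> conn r" if "(a, b) \<in> map_prod f f ` r" for a b
  proof (rule conn_edge)
    from that obtain a' b' where "(a', b') \<in> r" "a = f a'" "b = f b'" by auto
    moreover then have "a' \<in> X" "b' \<in> X" using assms(2) by auto
    ultimately show "(inv_into X f a, inv_into X f b) \<in> r" using assms(1) by simp
  qed
  show "(f a, f b) \<in> conn (map_prod f f ` r)" if "(a, b) \<in> r" for a b
    by (rule conn_edge) (use that in force)
  show "inv_into X f ` f ` X \<subseteq> X" using assms(1) by auto
  show "(f (inv_into X f y), y) \<in> conn (map_prod f f ` r)" if "y \<in> f ` X" for y
    using that by (simp add: f_inv_into_f)
  show "(inv_into X f (f x), x) \<in> conn r" if "x \<in> X" for x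
    using that assms(1) by simp
qed simp

text \<open>A saturated set is a union of classes. Numbers of classes thereby become dimensions over
  the field with two elements, which turns Euler's formula into a statement on dimensions.\<close>

lemma card_saturated_subsets:
  assumes "finite X" and "r \<subseteq> X \<times> X"
  shows "card {S. S \<subseteq> X \<and> (\<forall>(a, b)\<in>r. a \<in> S \<longleftrightarrow> b \<in> S)} = 2 ^ num_classes X r"
proof -
  let ?Q = "{S. S \<subseteq> X \<and> (\<forall>(a, b)\<in>r. a \<in> S \<longleftrightarrow> b \<in> S)}"
  have sub: "b \<in> X" if "(a, b) \<in> conn r" "a \<in> X" for a b
    using that by (induction rule: conn_induct) (use assms(2) in auto)
  have sat: "a \<in> S \<longleftrightarrow> b \<in> S" if "(a, b) \<in> conn r" "S \<in> ?Q" for a b S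
    using that by (induction rule: conn_induct) auto
  have disj: "conn r `` {a} \<in> C"
    if C: "C \<subseteq> X // conn r" and a: "a \<in> \<Union>C" for a C
  proof -
    from a obtain c where "c \<in> C" "a \<in> c" by blast
    then obtain b where "c = conn r `` {b}" "(b, a) \<in> conn r" using C by (auto simp: quotient_def)
    then show ?thesis using \<open>c \<in> C\<close> by (metis conn_image_eq)
  qed
  have "bij_betw Union (Pow (X // conn r)) ?Q"
  proof (rule bij_betw_byWitness[where f' = "\<lambda>S. S // conn r"])
    show "\<forall>C\<in>Pow (X // conn r). \<Union>C // conn r = C"
    proof
      fix C assume "C \<in> Pow (X // conn r)"
      then have C: "C \<subseteq> X // conn r" by simp
      show "\<Union>C // conn r = C"
      proof (intro equalityI subsetI)
        fix c assume "c \<in> \<Union>C // conn r"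
        then show "c \<in> C" using disj[OF C] by (auto simp: quotient_def)
      next
        fix c assume c: "c \<in> C"
        then obtain b where "c = conn r `` {b}" using C by (auto simp: quotient_def)
        then have "b \<in> \<Union>C" using c by (metis Image_singleton_iff UnionI conn_refl)
        then show "c \<in> \<Union>C // conn r" using \<open>c = conn r `` {b}\<close> by (simp add: quotientI)
      qed
    qed
    show "\<forall>S\<in>?Q. \<Union>(S // conn r) = S"
    proof
      fix S assume S: "S \<in> ?Q"
      show "\<Union>(S // conn r) = S"
      proof (intro equalityI subsetI)
        fix x assume "x \<in> \<Union>(S // conn r)"
        then show "x \<in> S" using sat[OF _ S] by (auto elim!: quotientE)
      next
        fix x assume "x \<in> S"
        then have "conn r `` {x} \<in> S // conn r" by (rule quotientI)
        then show "x \<in> \<Union>(S // conn r)" using conn_refl[of x r] by blast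
      qed
    qed
    show "Union ` Pow (X // conn r) \<subseteq> ?Q"
    proof clarsimp
      fix C assume C: "C \<subseteq> X // conn r"
      have "\<Union>C \<subseteq> X" using C sub by (auto simp: quotient_def subset_eq)
      moreover have "a \<in> \<Union>C \<longleftrightarrow> b \<in> \<Union>C" if "(a, b) \<in> r" for a b
      proof -
        have "(a, b) \<in> conn r" using that by (rule conn_edge)
        then have "conn r `` {a} = conn r `` {b}" by (simp add: conn_image_eq)
        then show ?thesis using disj[OF C]
          by (metis Image_singleton_iff UnionI conn_refl)
      qed
      ultimately show "\<Union>C \<subseteq> X \<and> (\<forall>x\<in>r. case x of (a, b) \<Rightarrow> (\<exists>x\<in>C. a \<in> x) = (\<exists>x\<in>C. b \<in> x))"
        by fastforce
    qed
    show "(\<lambda>S. S // conn r) ` ?Q \<subseteq> Pow (X // conn r)"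
      by (auto simp: quotient_def)
  qed
  then have "card ?Q = card (Pow (X // conn r))" by (simp add: bij_betw_same_card)
  then show ?thesis using assms(1) by (simp add: card_Pow num_classes_conn quotient_def)
qed

section \<open>The Kauffman bracket\<close>

lemma set_ends: "set (ends t) = set_tile t"
  by (cases t) auto

lemma finite_labels: "finite (labels D)"
  by (simp add: labels_def flip: set_ends)

lemma labels_Nil [simp]: "labels [] = {}"
  by (simp add: labels_def)

lemma labels_Cons [simp]: "labels (t # D) = set_tile t \<union> labels D"
  by (simp add: labels_def)

lemma labels_append [simp]: "labels (D @ E) = labels D \<union> labels E"
  by (simp add: labels_def)

lemma labels_map: "labels (map (map_tile f) D) = f ` labels D"
  by (auto simp: labels_def tile.set_map)

lemma labels_mset_cong: "mset D = mset E \<Longrightarrow> labels D = labels E"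
  by (simp add: labels_def flip: set_mset_mset)

fun is_real :: "'l tile \<Rightarrow> bool" where
  "is_real (RealX a b c d) = True"
| "is_real (VirtX a b c d) = False"
| "is_real (Arc a b) = False"

lemma is_real_iff: "is_real t \<longleftrightarrow> (\<exists>a b c d. t = RealX a b c d)"
  by (cases t) auto

definition spliced_strands :: "splice \<Rightarrow> 'l tile \<Rightarrow> ('l \<times> 'l) set" where
  "spliced_strands s t = (\<Union>u\<in>set (splice_tile s t). strands u)"

lemma spliced_strands_simps [simp]:
  "spliced_strands A (RealX a b c d) = {(a, b), (c, d)}"
  "spliced_strands B (RealX a b c d) = {(a, d), (b, c)}"
  "spliced_strands s (VirtX a b c d) = {(a, c), (b, d)}"
  "spliced_strands s (Arc a b) = {(a, b)}"
  by (auto simp: spliced_strands_def)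

lemma spliced_strands_map:
  "spliced_strands s (map_tile f t) = map_prod f f ` spliced_strands s t"
  by (cases t; cases s) auto

lemma spliced_strands_subset: "spliced_strands s t \<subseteq> set_tile t \<times> set_tile t"
  by (cases t; cases s) auto

text \<open>The state sum as a recursion over the tiles: \<open>r\<close> collects the strands of
  the tiles already spliced, and \<open>X\<close> is kept apart from the code so that it still
  contains their labels. With \<open>w A\<close> and \<open>w B\<close> inverse to each other, the
  base case is the usual loop value to the number of circles.\<close>

fun bracket :: "(splice \<Rightarrow> 'a::comm_ring_1) \<Rightarrow> nat set \<Rightarrow> (nat \<times> nat) set \<Rightarrow> code \<Rightarrow> 'a" where
  "bracket w X r [] = (- (w A)\<^sup>2 - (w B)\<^sup>2) ^ num_classes X r"
| "bracket w X r (t # D) =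
    (if is_real t
     then w A * bracket w X (r \<union> spliced_strands A t) D + w B * bracket w X (r \<union> spliced_strands B t) D
     else bracket w X (r \<union> spliced_strands A t) D)"

text \<open>The two brackets agree state by state: \<open>S\<close> stands for the strands that some
  state of \<open>D\<close> adds to \<open>r\<close>, and \<open>k\<close> counts circles split off.
  Every comparison of brackets over the same list of tiles thus reduces to one of class
  numbers.\<close>

lemma bracket_transfer:
  assumes "\<And>S. S \<subseteq> labels D \<times> labels D \<Longrightarrow>
    num_classes X (r \<union> S) = k + num_classes Y (r' \<union> map_prod f f ` S)"
  shows "bracket w X r D = (- (w A)\<^sup>2 - (w B)\<^sup>2) ^ k * bracket w Y r' (map (map_tile f) D)"
  using assms
proof (induction D arbitrary: r r')
  case Nil
  from Nil[of "{}"] show ?case by (simp add: power_add)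
next
  case (Cons t D)
  have "bracket w X (r \<union> spliced_strands s t) D = (- (w A)\<^sup>2 - (w B)\<^sup>2) ^ k *
      bracket w Y (r' \<union> spliced_strands s (map_tile f t)) (map (map_tile f) D)" for s
  proof (rule Cons.IH)
    fix S assume "S \<subseteq> labels D \<times> labels D"
    then have "spliced_strands s t \<union> S \<subseteq> labels (t # D) \<times> labels (t # D)"
      using spliced_strands_subset[of s t] by auto
    from Cons.prems[OF this]
    show "num_classes X (r \<union> spliced_strands s t \<union> S) =
        k + num_classes Y (r' \<union> spliced_strands s (map_tile f t) \<union> map_prod f f ` S)"
      by (simp add: spliced_strands_map image_Un Un_assoc)
  qed
  moreover have "is_real (map_tile f t) = is_real t" by (cases t) auto
  ultimately show ?case by (simp add: algebra_simps)
qed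

lemma map_tile_fresh:
  assumes "x \<notin> labels D"
  shows "map (map_tile (id(x := u))) D = D"
proof (rule map_idI)
  fix t assume "t \<in> set D"
  then have "x \<notin> set_tile t" using assms by (auto simp: labels_def)
  then have "map_tile (id(x := u)) t = map_tile id t" by (intro tile.map_cong) auto
  then show "map_tile (id(x := u)) t = t" by (simp add: tile.map_id)
qed

lemma bracket_contract:
  assumes "b \<noteq> a" and "b \<notin> X" and "a \<in> X"
  shows "bracket w (insert b X) (insert (a, b) r) D =
    bracket w X (map_prod (id(b := a)) (id(b := a)) ` r) (map (map_tile (id(b := a))) D)"
  using bracket_transfer[of D "insert b X" "insert (a, b) r" 0 X
      "map_prod (id(b := a)) (id(b := a)) ` r" "id(b := a)" w]
    num_classes_contract[OF assms]
  by (simp flip: image_Un)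

lemma bracket_isolated:
  assumes "finite X" and "x \<notin> X" and "x \<notin> Field r" and "x \<notin> labels D"
  shows "bracket w (insert x X) r D = (- (w A)\<^sup>2 - (w B)\<^sup>2) * bracket w X r D"
proof -
  have "x \<notin> Field (r \<union> S)" if "S \<subseteq> labels D \<times> labels D" for S
    using that assms(3,4) by (auto simp: Field_def)
  then show ?thesis
    using bracket_transfer[of D "insert x X" r 1 X r id w] num_classes_isolated[OF assms(1,2)]
    by (simp add: tile.map_id0 prod.map_id0)
qed

lemma bracket_cong:
  assumes "r \<subseteq> conn r'" and "r' \<subseteq> conn r"
  shows "bracket w X r D = bracket w X r' D"
proof -
  have "num_classes X (r \<union> S) = num_classes X (r' \<union> S)" for S
    by (rule num_classes_cong) (use assms in \<open>auto intro: conn_edge conn_mono[OF subsetD]\<close>)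
  then show ?thesis
    using bracket_transfer[of D X r 0 X r' id w] by (simp add: tile.map_id0 prod.map_id0)
qed

lemma bracket_rename:
  assumes "inj_on f X" and "labels D \<subseteq> X"
  shows "bracket w X {} D = bracket w (f ` X) {} (map (map_tile f) D)"
  using bracket_transfer[of D X "{}" 0 "f ` X" "{}" f w] num_classes_rename[OF assms(1)] assms(2)
  by (simp add: Sigma_mono subset_trans[OF _ Sigma_mono])

lemma bracket_swap: "bracket w X r (t # u # D) = bracket w X r (u # t # D)"
  by (simp add: algebra_simps Un_ac)

lemma bracket_Cons_cong:
  "(\<And>r. bracket w X r D = bracket w X r E) \<Longrightarrow> bracket w X r (t # D) = bracket w X r (t # E)"
  by simp

lemma bracket_move_front: "bracket w X r (D1 @ t # D2) = bracket w X r (t # D1 @ D2)"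
proof (induction D1 arbitrary: r)
  case (Cons u D1)
  have "bracket w X r ((u # D1) @ t # D2) = bracket w X r (u # t # D1 @ D2)"
    using bracket_Cons_cong[OF Cons] by simp
  then show ?case by (simp only: bracket_swap append_Cons)
qed simp

lemma bracket_mset_cong:
  assumes "mset D = mset E"
  shows "bracket w X r D = bracket w X r E"
  using assms
proof (induction D arbitrary: E r)
  case (Cons t D)
  then obtain E1 E2 where E: "E = E1 @ t # E2"
    by (metis list.set_intros(1) set_mset_mset split_list)
  with Cons.prems have "mset D = mset (E1 @ E2)" by simp
  then have "bracket w X r' D = bracket w X r' (E1 @ E2)" for r' by (rule Cons.IH)
  then show ?case unfolding E bracket_move_front by simp
qed simp

definition kauffman_bracket :: "(splice \<Rightarrow> 'a::comm_ring_1) \<Rightarrow> code \<Rightarrow> 'a" where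
  "kauffman_bracket w D = bracket w (labels D) {} D"

text \<open>The returned label is the other end of the first edge at \<open>x\<close>. It is
  \<open>x\<close> itself in two cases, when that edge is a loop and when no edge touches
  \<open>x\<close>.\<close>

fun pick_edge :: "'a \<Rightarrow> ('a \<times> 'a) list \<Rightarrow> 'a \<times> ('a \<times> 'a) list" where
  "pick_edge x [] = (x, [])"
| "pick_edge x ((a, b) # es) =
    (if a = x then (b, es) else if b = x then (a, es)
     else let (u, es') = pick_edge x es in (u, (a, b) # es'))"

text \<open>
  With the local strands as an explicit list, the simplifier can eliminate the labels inside the disc of
  a move one after the other; as sets of unordered edges, the remaining terms can be compared by
  \<open>insert_commute\<close>.
\<close>

definition list_bracket ::
  "(splice \<Rightarrow> 'a::comm_ring_1) \<Rightarrow> nat set \<Rightarrow> (nat \<times> nat) list \<Rightarrow> code \<Rightarrow> 'a" where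
  "list_bracket w X es D = bracket w X (set es) D"

definition edge_bracket ::
  "(splice \<Rightarrow> 'a::comm_ring_1) \<Rightarrow> nat set \<Rightarrow> nat set set \<Rightarrow> code \<Rightarrow> 'a" where
  "edge_bracket w X U D = bracket w X {(a, b). {a, b} \<in> U} D"

lemma list_bracket_edge_bracket:
  "list_bracket w X es D = edge_bracket w X (set (map (\<lambda>(a, b). {a, b}) es)) D"
  unfolding list_bracket_def edge_bracket_def
proof (rule bracket_cong)
  let ?r = "{(a, b). {a, b} \<in> set (map (\<lambda>(a, b). {a, b}) es)}"
  have "{a, b} \<in> set (map (\<lambda>(a, b). {a, b}) es)" if "(a, b) \<in> set es" for a b
    using imageI[OF that, of "\<lambda>(a, b). {a, b}"] by simp
  then show "set es \<subseteq> conn ?r" by (auto intro!: conn_edge)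
  show "?r \<subseteq> conn (set es)"
  proof clarify
    fix a b assume "{a, b} \<in> set (map (\<lambda>(a, b). {a, b}) es)"
    then obtain c d where "(c, d) \<in> set es" "{a, b} = {c, d}" by auto
    then have "(a, b) = (c, d) \<or> (b, a) = (c, d)" by (auto simp: doubleton_eq_iff)
    then show "(a, b) \<in> conn (set es)"
      using conn_edge[OF \<open>(c, d) \<in> set es\<close>] conn_sym[of b a] by auto
  qed
qed

lemma list_bracket_Cons:
  "list_bracket w X es (RealX a b c d # D) =
     w A * list_bracket w X ((a, b) # (c, d) # es) D + w B * list_bracket w X ((a, d) # (b, c) # es) D"
  "list_bracket w X es (VirtX a b c d # D) = list_bracket w X ((a, c) # (b, d) # es) D"
  "list_bracket w X es (Arc a b # D) = list_bracket w X ((a, b) # es) D"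
  by (simp_all add: list_bracket_def)

lemma pick_edge_set:
  "pick_edge x es = (u, es') \<Longrightarrow>
    es' = es \<and> u = x \<and> x \<notin> Field (set es) \<or>
    (set es = insert (x, u) (set es') \<or> set es = insert (u, x) (set es'))"
  by (induction es arbitrary: es') (auto split: if_splits prod.splits)

text \<open>If \<open>pick_edge\<close> returns \<open>x\<close>, nothing but a possible loop
  touches \<open>x\<close>, which is then a free circle and yields the loop value; otherwise
  \<open>x\<close> is contracted onto its neighbour. The last hypothesis is one that the simplifier
  decides on a concrete list.\<close>

lemma list_bracket_elim:
  assumes "finite X" and "x \<notin> X" and "x \<notin> labels D"
    and "case pick_edge x es of (u, es') \<Rightarrow>
      if u = x then x \<notin> set (map fst es') \<union> set (map snd es') else u \<in> X"
  shows "list_bracket w (insert x X) es D =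
    (let (u, es') = pick_edge x es
     in if u = x then (- (w A)\<^sup>2 - (w B)\<^sup>2) * list_bracket w X es' D
     else list_bracket w X (map (map_prod (id(x := u)) (id(x := u))) es') D)"
proof -
  obtain u es' where pick: "pick_edge x es = (u, es')" by fastforce
  show ?thesis
  proof (cases "u = x")
    case True
    then have "x \<notin> Field (set es')" using assms(4) pick by (force simp: Field_def)
    moreover have "list_bracket w (insert x X) es D = list_bracket w (insert x X) es' D"
      unfolding list_bracket_def
      by (rule bracket_cong) (use pick_edge_set[OF pick] True in \<open>auto intro: conn_edge\<close>)
    ultimately show ?thesis
      using True bracket_isolated[OF assms(1,2) _ assms(3)] by (simp add: list_bracket_def pick)
  next
    case False
    then have "u \<in> X" using assms(4) pick by simp
    have "list_bracket w (insert x X) es D = bracket w (insert x X) (insert (u, x) (set es')) D"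
      unfolding list_bracket_def
      by (rule bracket_cong)
        (use pick_edge_set[OF pick] False in \<open>auto intro: conn_edge conn_sym[OF conn_edge]\<close>)
    also have "\<dots> = bracket w X (map_prod (id(x := u)) (id(x := u)) ` set es') D"
      using bracket_contract[of x u X w "set es'" D] False assms(2) \<open>u \<in> X\<close> map_tile_fresh[OF assms(3)]
      by auto
    finally show ?thesis using False by (simp add: list_bracket_def pick)
  qed
qed

section \<open>Invariance under the moves\<close>

context
  fixes w :: "splice \<Rightarrow> 'a::comm_ring_1" and X :: "nat set" and M :: code
    and x y z p q r s p1 p2 p3 p4 p5 p6 :: nat
  assumes inv: "w A * w B = 1" and fin: "finite X"
begin

lemma inv_left: "w A * (w B * t) = t" "w B * (w A * t) = t" "w B * w A = 1"
proof -
  show "w B * w A = 1" using inv by (simp only: mult.commute)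
  then show "w A * (w B * t) = t" "w B * (w A * t) = t" using inv by (simp_all flip: mult.assoc)
qed

lemmas ring_simps = algebra_simps power2_eq_square power3_eq_cube inv inv_left
lemmas to_edges = list_bracket_edge_bracket insert_commute

context
  assumes fresh: "x \<notin> X" "x \<notin> labels M" and outer: "p \<in> X" "q \<in> X"
begin

lemma neq1: "x \<noteq> p" "x \<noteq> q" "p \<noteq> x" "q \<noteq> x"
  using fresh outer by auto

lemmas elim_simps1 = list_bracket_elim fresh outer neq1 fin

text \<open>The A-splice cuts off a circle while the B-splice straightens the strand, so the curl
  has the value \<open>w A\<close> times the loop value plus \<open>w B\<close>. In
  \<open>bracket_R1'\<close> the splices change roles.\<close>

lemma bracket_R1:
  "list_bracket w (insert x X) [] (RealX x x p q # M) =
    - (w A ^ 3) * list_bracket w X [] (Arc p q # M)"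
proof -
  have "w A * (- (w A)\<^sup>2 - (w B)\<^sup>2) + w B = - (w A ^ 3)" by (simp add: ring_simps)
  then show ?thesis
    by (simp only: list_bracket_Cons, simp add: elim_simps1,
        simp add: to_edges flip: distrib_right mult.assoc)
qed

lemma bracket_R1':
  "list_bracket w (insert x X) [] (RealX p x x q # M) =
    - (w B ^ 3) * list_bracket w X [] (Arc p q # M)"
proof -
  have "w A + w B * (- (w A)\<^sup>2 - (w B)\<^sup>2) = - (w B ^ 3)" by (simp add: ring_simps)
  then show ?thesis
    by (simp only: list_bracket_Cons, simp add: elim_simps1,
        simp add: to_edges flip: distrib_right mult.assoc)
qed

lemma bracket_V1:
  "list_bracket w (insert x X) [] (VirtX x x p q # M) = list_bracket w X [] (Arc p q # M)"
  by (simp only: list_bracket_Cons, simp add: elim_simps1)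

end

context
  assumes fresh: "x \<notin> X" "y \<notin> X" "x \<noteq> y" "x \<notin> labels M" "y \<notin> labels M"
    and outer: "p \<in> X" "q \<in> X" "r \<in> X" "s \<in> X"
begin

lemma neq2: "x \<noteq> p" "x \<noteq> q" "x \<noteq> r" "x \<noteq> s" "y \<noteq> p" "y \<noteq> q" "y \<noteq> r" "y \<noteq> s"
  using fresh outer by auto

lemmas elim_simps2 = list_bracket_elim fresh fresh(3)[symmetric] outer neq2 neq2[symmetric] fin

text \<open>Three of the four states join \<open>p\<close> to \<open>r\<close> and \<open>s\<close>
  to \<open>q\<close>. Their coefficients are \<open>(w A)\<^sup>2\<close>,
  \<open>(w B)\<^sup>2\<close> and, for the one with a circle, the loop value, and these add up to
  0. The fourth state has the strands of the right-hand side with coefficient 1.\<close>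

lemma bracket_R2:
  "list_bracket w (insert x (insert y X)) [] (RealX p r x y # RealX x s q y # M) =
    list_bracket w X [] (Arc p q # Arc r s # M)"
  by (simp only: list_bracket_Cons, simp add: elim_simps2, simp add: to_edges, simp add: ring_simps)

lemma bracket_V2:
  "list_bracket w (insert x (insert y X)) [] (VirtX p r x y # VirtX x s q y # M) =
    list_bracket w X [] (Arc p q # Arc r s # M)"
  by (simp only: list_bracket_Cons, simp add: elim_simps2, simp add: to_edges)

end

context
  assumes fresh: "x \<notin> X" "y \<notin> X" "z \<notin> X" "x \<notin> labels M" "y \<notin> labels M" "z \<notin> labels M"
    and inner: "x \<noteq> y" "x \<noteq> z" "y \<noteq> z"
    and outer: "p1 \<in> X" "p2 \<in> X" "p3 \<in> X" "p4 \<in> X" "p5 \<in> X" "p6 \<in> X"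
begin

lemma neq3:
  "x \<noteq> p1" "x \<noteq> p2" "x \<noteq> p3" "x \<noteq> p4" "x \<noteq> p5" "x \<noteq> p6"
  "y \<noteq> p1" "y \<noteq> p2" "y \<noteq> p3" "y \<noteq> p4" "y \<noteq> p5" "y \<noteq> p6"
  "z \<noteq> p1" "z \<noteq> p2" "z \<noteq> p3" "z \<noteq> p4" "z \<noteq> p5" "z \<noteq> p6"
  using fresh outer by auto

lemmas elim_simps3 = list_bracket_elim fresh inner inner[symmetric] outer neq3 neq3[symmetric] fin

text \<open>Both sides are expanded into their eight states and compared after the inner labels are
  gone, in place of the classical argument that splices one crossing and applies the second move
  twice.\<close>

lemma bracket_R3:
  "list_bracket w (insert x (insert y (insert z X))) []
      (RealX p1 p2 x y # RealX x p3 p4 z # RealX y z p5 p6 # M) =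
    list_bracket w (insert x (insert y (insert z X))) []
      (RealX x y p4 p5 # RealX p1 z x p6 # RealX p2 p3 y z # M)"
  by (simp only: list_bracket_Cons, simp add: elim_simps3, simp add: to_edges, simp add: ring_simps)

lemma bracket_R3':
  "list_bracket w (insert x (insert y (insert z X))) []
      (RealX p1 p2 x y # RealX x p3 p4 z # RealX z p5 p6 y # M) =
    list_bracket w (insert x (insert y (insert z X))) []
      (RealX x y p4 p5 # RealX p1 z x p6 # RealX p3 y z p2 # M)"
  by (simp only: list_bracket_Cons, simp add: elim_simps3, simp add: to_edges, simp add: ring_simps)

lemma bracket_V3:
  "list_bracket w (insert x (insert y (insert z X))) []
      (VirtX p1 p2 x y # VirtX x p3 p4 z # VirtX y z p5 p6 # M) =
    list_bracket w (insert x (insert y (insert z X))) []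
      (VirtX x y p4 p5 # VirtX p1 z x p6 # VirtX p2 p3 y z # M)"
  by (simp only: list_bracket_Cons, simp add: elim_simps3)

text \<open>Virtual crossings enter only through their strands, so the two splices of the one real
  crossing can be compared separately; each gives the same connection of \<open>p1\<close>, ...,
  \<open>p6\<close> on both sides.\<close>

lemma bracket_V4:
  "list_bracket w (insert x (insert y (insert z X))) []
      (VirtX p1 p2 x y # VirtX x p3 p4 z # RealX y z p5 p6 # M) =
    list_bracket w (insert x (insert y (insert z X))) []
      (VirtX x y p4 p5 # VirtX p1 z x p6 # RealX p2 p3 y z # M)"
  by (simp only: list_bracket_Cons, simp add: elim_simps3, simp add: to_edges)

lemma bracket_V4':
  "list_bracket w (insert x (insert y (insert z X))) []
      (VirtX p1 p2 x y # VirtX x p3 p4 z # RealX z p5 p6 y # M) =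
    list_bracket w (insert x (insert y (insert z X))) []
      (VirtX x y p4 p5 # VirtX p1 z x p6 # RealX p3 y z p2 # M)"
  by (simp only: list_bracket_Cons, simp add: elim_simps3, simp add: to_edges)

end
end

section \<open>Local moves inside a well-formed code\<close>

definition occurrences :: "code \<Rightarrow> nat \<Rightarrow> nat" where
  "occurrences D l = count_list (concat (map ends D)) l"

lemma occurrences_Cons: "occurrences (t # D) l = count_list (ends t) l + occurrences D l"
  by (simp add: occurrences_def)

lemma occurrences_0_iff: "occurrences D l = 0 \<longleftrightarrow> l \<notin> labels D"
  by (simp add: occurrences_def count_list_0_iff labels_def set_ends)

lemma occurrences_mset_cong:
  assumes "mset D = mset E"
  shows "occurrences D l = occurrences E l"
proof -
  have "occurrences D l = (\<Sum>t\<in>#mset D. count_list (ends t) l)" for D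
    by (induction D) (auto simp: occurrences_Cons, simp add: occurrences_def)
  then show ?thesis using assms by metis
qed

lemma well_formed_iff: "well_formed D \<longleftrightarrow> (\<forall>l\<in>labels D. occurrences D l = 2)"
  by (simp add: well_formed_def occurrences_def)

lemma well_formed_mset_cong: "mset D = mset E \<Longrightarrow> well_formed D \<Longrightarrow> well_formed E"
  using occurrences_mset_cong labels_mset_cong unfolding well_formed_iff by metis

lemma kauffman_bracket_mset_cong:
  "mset D = mset E \<Longrightarrow> kauffman_bracket w D = kauffman_bracket w E"
  unfolding kauffman_bracket_def by (simp add: bracket_mset_cong[of D E] labels_mset_cong[of D E])

lemma kauffman_bracket_list_bracket: "kauffman_bracket w D = list_bracket w (labels D) [] D"
  by (simp add: kauffman_bracket_def list_bracket_def)

text \<open>Well-formedness grants a label two occurrences, and an inner label has used up both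
  inside the disc.\<close>

lemma fresh_if_twice:
  assumes "well_formed (ts @ M)" and "mset (concat (map ends ts)) = mset (x # x # ls)"
  shows "x \<notin> set ls \<union> labels M"
proof -
  have count: "count_list (concat (map ends ts)) x = 2 + count_list ls x"
    using arg_cong[OF assms(2), of "\<lambda>m. count m x"] by (simp add: count_mset)
  then have "x \<in> set (concat (map ends ts))" by (metis count_list_0_iff add_is_0 zero_neq_numeral)
  then have "x \<in> labels (ts @ M)" by (auto simp: labels_def set_ends)
  then have "occurrences (ts @ M) x = 2" using assms(1) well_formed_iff by blast
  then have "count_list ls x + occurrences M x = 0" using count by (simp add: occurrences_def)
  then show ?thesis by (simp add: occurrences_0_iff count_list_0_iff)
qed

lemma kauffman_bracket_local:
  fixes w :: "splice \<Rightarrow> 'a::comm_ring_1"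
  assumes move: "reidemeister L R \<or> virtual_reidemeister L R" and inv: "w A * w B = 1"
    and D: "mset D = L + mset M" "well_formed D" and E: "mset E = R + mset M"
  shows "\<exists>u\<in>{1, - (w A ^ 3), - (w B ^ 3)}. kauffman_bracket w D = u * kauffman_bracket w E"
proof -
  have cong: "kauffman_bracket w D = list_bracket w (labels (ts @ M)) [] (ts @ M)" "well_formed (ts @ M)"
    if "L = mset ts" for ts
    using that D kauffman_bracket_mset_cong[of D "ts @ M" w] well_formed_mset_cong[of D "ts @ M"]
    by (auto simp: kauffman_bracket_list_bracket)
  have cong': "kauffman_bracket w E = list_bracket w (labels (ts @ M)) [] (ts @ M)"
    if "R = mset ts" for ts
    using that E kauffman_bracket_mset_cong[of E "ts @ M" w] by (auto simp: kauffman_bracket_list_bracket)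
  have one: "x \<noteq> p \<and> x \<noteq> q \<and> x \<notin> labels M"
    if "well_formed ([t] @ M)" "ends t \<in> {[x, x, p, q], [p, x, x, q]}" for t x p q
    using fresh_if_twice[OF that(1), of x "[p, q]"] that(2) by auto
  have two: "x \<notin> {y, p, q, r, s} \<union> labels M \<and> y \<notin> {x, p, q, r, s} \<union> labels M"
    if "well_formed ([t, t'] @ M)" "ends t = [p, r, x, y]" "ends t' = [x, s, q, y]" for t t' x y p q r s
    using fresh_if_twice[OF that(1), of x "[p, r, y, s, q, y]"] fresh_if_twice[OF that(1), of y "[p, r, x, x, s, q]"]
      that(2,3) by auto
  \<comment> \<open>With the ends as multisets, one claim serves all five three-strand
    moves.\<close>
  have three: "x \<notin> {y, z, p1, p2, p3, p4, p5, p6} \<union> labels M \<and>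
      y \<notin> {z, p1, p2, p3, p4, p5, p6} \<union> labels M \<and> z \<notin> {p1, p2, p3, p4, p5, p6} \<union> labels M"
    if wf: "well_formed ([t, t', t''] @ M)" and ends: "mset (ends t) = mset [x, y, p1, p2]"
      "mset (ends t') = mset [x, z, p3, p4]" "mset (ends t'') = mset [y, z, p5, p6]"
    for t t' t'' x y z p1 p2 p3 p4 p5 p6
  proof -
    have "mset (concat (map ends [t, t', t''])) = mset (x # x # [y, y, z, z, p1, p2, p3, p4, p5, p6])"
      "mset (concat (map ends [t, t', t''])) = mset (y # y # [x, x, z, z, p1, p2, p3, p4, p5, p6])"
      "mset (concat (map ends [t, t', t''])) = mset (z # z # [x, x, y, y, p1, p2, p3, p4, p5, p6])"
      by (simp_all add: ends)
    from this[THEN fresh_if_twice[OF wf]] show ?thesis by simp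
  qed
  note fin = finite_labels[of M]
  from move show ?thesis
  proof (elim disjE)
    assume "reidemeister L R"
    then show ?thesis
    proof cases
      case (R1 x p q)
      \<comment> \<open>The boundary labels are added to \<open>labels M\<close> because they may be
        missing there: \<open>p = q\<close> is possible, the curl being closed up to a circle. The
        same holds for the other moves.\<close>
      have "kauffman_bracket w D = - (w A ^ 3) * kauffman_bracket w E"
        using cong[of "[RealX x x p q]"] cong'[of "[Arc p q]"] one[of "RealX x x p q" x p q]
          bracket_R1[OF inv, of "{p, q} \<union> labels M" x M p q] fin R1
        by (simp add: insert_commute)
      then show ?thesis by blast
    next
      case (R1' p x q)
      have "kauffman_bracket w D = - (w B ^ 3) * kauffman_bracket w E"
        using cong[of "[RealX p x x q]"] cong'[of "[Arc p q]"] one[of "RealX p x x q" x p q]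
          bracket_R1'[OF inv, of "{p, q} \<union> labels M" x M p q] fin R1'
        by (simp add: insert_commute)
      then show ?thesis by blast
    next
      case (R2 p r x y s q)
      have "kauffman_bracket w D = kauffman_bracket w E"
        using cong[of "[RealX p r x y, RealX x s q y]"] cong'[of "[Arc p q, Arc r s]"]
          two[of "RealX p r x y" "RealX x s q y" p r x y s q]
          bracket_R2[OF inv, of "{p, q, r, s} \<union> labels M" x y M p q r s] fin R2
        by (simp add: insert_commute)
      then show ?thesis by simp
    next
      case (R3 p1 p2 x y p3 p4 z p5 p6)
      have "kauffman_bracket w D = kauffman_bracket w E"
        using cong[of "[RealX p1 p2 x y, RealX x p3 p4 z, RealX y z p5 p6]"]
          cong'[of "[RealX x y p4 p5, RealX p1 z x p6, RealX p2 p3 y z]"]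
          three[of "RealX p1 p2 x y" "RealX x p3 p4 z" "RealX y z p5 p6" x y p1 p2 z p3 p4 p5 p6]
          bracket_R3[OF inv, of "{p1, p2, p3, p4, p5, p6} \<union> labels M" x y z M p1 p2 p3 p4 p5 p6] fin R3
        by (simp add: insert_commute)
      then show ?thesis by simp
    next
      case (R3' p1 p2 x y p3 p4 z p5 p6)
      have "kauffman_bracket w D = kauffman_bracket w E"
        using cong[of "[RealX p1 p2 x y, RealX x p3 p4 z, RealX z p5 p6 y]"]
          cong'[of "[RealX x y p4 p5, RealX p1 z x p6, RealX p3 y z p2]"]
          three[of "RealX p1 p2 x y" "RealX x p3 p4 z" "RealX z p5 p6 y" x y p1 p2 z p3 p4 p5 p6]
          bracket_R3'[OF inv, of "{p1, p2, p3, p4, p5, p6} \<union> labels M" x y z M p1 p2 p3 p4 p5 p6] fin R3'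
        by (simp add: insert_commute)
      then show ?thesis by simp
    qed
  next
    assume "virtual_reidemeister L R"
    then show ?thesis
    proof cases
      case (V1 x p q)
      have "kauffman_bracket w D = kauffman_bracket w E"
        using cong[of "[VirtX x x p q]"] cong'[of "[Arc p q]"] one[of "VirtX x x p q" x p q]
          bracket_V1[OF inv, of "{p, q} \<union> labels M" x M p q] fin V1
        by (simp add: insert_commute)
      then show ?thesis by simp
    next
      case (V2 p r x y s q)
      have "kauffman_bracket w D = kauffman_bracket w E"
        using cong[of "[VirtX p r x y, VirtX x s q y]"] cong'[of "[Arc p q, Arc r s]"]
          two[of "VirtX p r x y" "VirtX x s q y" p r x y s q]
          bracket_V2[OF inv, of "{p, q, r, s} \<union> labels M" x y M p q r s] fin V2
        by (simp add: insert_commute)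
      then show ?thesis by simp
    next
      case (V3 p1 p2 x y p3 p4 z p5 p6)
      have "kauffman_bracket w D = kauffman_bracket w E"
        using cong[of "[VirtX p1 p2 x y, VirtX x p3 p4 z, VirtX y z p5 p6]"]
          cong'[of "[VirtX x y p4 p5, VirtX p1 z x p6, VirtX p2 p3 y z]"]
          three[of "VirtX p1 p2 x y" "VirtX x p3 p4 z" "VirtX y z p5 p6" x y p1 p2 z p3 p4 p5 p6]
          bracket_V3[OF inv, of "{p1, p2, p3, p4, p5, p6} \<union> labels M" x y z M p1 p2 p3 p4 p5 p6] fin V3
        by (simp add: insert_commute)
      then show ?thesis by simp
    next
      case (V4 p1 p2 x y p3 p4 z p5 p6)
      have "kauffman_bracket w D = kauffman_bracket w E"
        using cong[of "[VirtX p1 p2 x y, VirtX x p3 p4 z, RealX y z p5 p6]"]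
          cong'[of "[VirtX x y p4 p5, VirtX p1 z x p6, RealX p2 p3 y z]"]
          three[of "VirtX p1 p2 x y" "VirtX x p3 p4 z" "RealX y z p5 p6" x y p1 p2 z p3 p4 p5 p6]
          bracket_V4[OF inv, of "{p1, p2, p3, p4, p5, p6} \<union> labels M" x y z M p1 p2 p3 p4 p5 p6] fin V4
        by (simp add: insert_commute)
      then show ?thesis by simp
    next
      case (V4' p1 p2 x y p3 p4 z p5 p6)
      have "kauffman_bracket w D = kauffman_bracket w E"
        using cong[of "[VirtX p1 p2 x y, VirtX x p3 p4 z, RealX z p5 p6 y]"]
          cong'[of "[VirtX x y p4 p5, VirtX p1 z x p6, RealX p3 y z p2]"]
          three[of "VirtX p1 p2 x y" "VirtX x p3 p4 z" "RealX z p5 p6 y" x y p1 p2 z p3 p4 p5 p6]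
          bracket_V4'[OF inv, of "{p1, p2, p3, p4, p5, p6} \<union> labels M" x y z M p1 p2 p3 p4 p5 p6] fin V4'
        by (simp add: insert_commute)
      then show ?thesis by simp
    qed
  qed
qed

lemma kauffman_bracket_list_update:
  assumes i: "i < length D" "D ! i = t" and t': "set_tile t' = set_tile t" "is_real t' = is_real t"
    and flip: "\<And>s. spliced_strands s t \<union> (spliced_strands s t)\<inverse> =
      spliced_strands s t' \<union> (spliced_strands s t')\<inverse>"
  shows "kauffman_bracket w (D[i := t']) = kauffman_bracket w D"
proof -
  let ?R = "take i D @ drop (Suc i) D"
  have D: "mset D = mset (t # ?R)" using id_take_nth_drop[OF i(1)] i(2)
    by (metis add_mset_commute mset.simps(2) mset_append union_mset_add_mset_right)
  have D': "mset (D[i := t']) = mset (t' # ?R)" using upd_conv_take_nth_drop[OF i(1)] by simp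
  have sub: "r \<subseteq> conn r'" if "r \<union> r\<inverse> = r' \<union> r'\<inverse>" for r r' :: "(nat \<times> nat) set"
  proof (rule subrelI)
    fix a b assume "(a, b) \<in> r"
    then have "(a, b) \<in> r' \<union> r'\<inverse>" using that by blast
    then show "(a, b) \<in> conn r'" using conn_edge conn_sym by fastforce
  qed
  have "bracket w X (spliced_strands s t') ?R = bracket w X (spliced_strands s t) ?R" for s X
    by (intro bracket_cong sub) (simp_all add: flip)
  then have "bracket w X {} (t' # ?R) = bracket w X {} (t # ?R)" for X by (simp add: t')
  then have "kauffman_bracket w (t' # ?R) = kauffman_bracket w (t # ?R)"
    using t' by (simp add: kauffman_bracket_def del: bracket.simps)
  then show ?thesis using D D' kauffman_bracket_mset_cong by metis
qed

lemma kauffman_bracket_recoding: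
  assumes "recoding D E" and "well_formed D"
  shows "kauffman_bracket w D = kauffman_bracket w E"
  using assms(1)
proof cases
  case reorder
  then show ?thesis by (rule kauffman_bracket_mset_cong)
next
  case (rename f)
  then show ?thesis
    using bracket_rename[OF _ subset_refl] by (simp add: kauffman_bracket_def labels_map)
next
  case (turn_real i a b c d)
  have "spliced_strands s (RealX a b c d) \<union> (spliced_strands s (RealX a b c d))\<inverse> =
      spliced_strands s (RealX c d a b) \<union> (spliced_strands s (RealX c d a b))\<inverse>" for s
    by (cases s) auto
  moreover have "set_tile (RealX c d a b) = set_tile (RealX a b c d)" by auto
  moreover have "is_real (RealX c d a b) = is_real (RealX a b c d)" by simp
  ultimately show ?thesis
    using kauffman_bracket_list_update turn_real(1,2,3) by metis
next
  case (turn_virt i a b c d)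
  have "spliced_strands s (VirtX a b c d) \<union> (spliced_strands s (VirtX a b c d))\<inverse> =
      spliced_strands s (VirtX b c d a) \<union> (spliced_strands s (VirtX b c d a))\<inverse>" for s
    by (cases s) auto
  moreover have "set_tile (VirtX b c d a) = set_tile (VirtX a b c d)" by auto
  moreover have "is_real (VirtX b c d a) = is_real (VirtX a b c d)" by simp
  ultimately show ?thesis
    using kauffman_bracket_list_update turn_virt(1,2,3) by metis
next
  case (turn_arc i a b)
  have "spliced_strands s (Arc a b) \<union> (spliced_strands s (Arc a b))\<inverse> =
      spliced_strands s (Arc b a) \<union> (spliced_strands s (Arc b a))\<inverse>" for s
    by (cases s) auto
  moreover have "set_tile (Arc b a) = set_tile (Arc a b)" by auto
  moreover have "is_real (Arc b a) = is_real (Arc a b)" by simp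
  ultimately show ?thesis
    using kauffman_bracket_list_update turn_arc(1,2,3) by metis
next
  case (unmark a b M)
  let ?f = "id(b := a)"
  \<comment> \<open>As \<open>a \<noteq> b\<close>, the arc uses only one of the two occurrences of
    \<open>a\<close>. The other one is in \<open>M\<close>, so \<open>a\<close> survives the
    contraction and no circle is lost.\<close>
  have "occurrences D a = 2" using assms(2) unmark by (simp add: well_formed_iff)
  then have "a \<in> labels M"
    using unmark occurrences_0_iff[of M a] by (simp add: occurrences_Cons)
  then have X: "a \<in> ?f ` labels M" "labels D = insert b (?f ` labels M)"
    using unmark by (auto simp: image_iff split: if_splits)
  moreover have "b \<notin> ?f ` labels M" using unmark by auto
  ultimately have "bracket w (labels D) {(a, b)} M = bracket w (?f ` labels M) {} (map (map_tile ?f) M)"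
    using bracket_contract[of b a "?f ` labels M" w "{}" M] unmark by simp
  then show ?thesis using unmark by (simp add: kauffman_bracket_def labels_map del: labels_Cons)
qed

lemma kauffman_bracket_move:
  fixes w :: "splice \<Rightarrow> 'a::comm_ring_1"
  assumes "move D E" and inv: "w A * w B = 1"
  shows "\<exists>u\<in>{1, - (w A ^ 3), - (w B ^ 3)}. kauffman_bracket w D = u * kauffman_bracket w E"
proof -
  have wf: "well_formed D" using assms(1) by (simp add: move_def virtual_diagram_def)
  consider "recoding D E" | L R M where "reidemeister L R \<or> virtual_reidemeister L R"
    "mset D = L + M" "mset E = R + M"
    using assms(1) by (auto simp: move_def)
  then show ?thesis
  proof cases
    case 1
    then show ?thesis using kauffman_bracket_recoding[OF _ wf, of E w] by simp
  next
    case 2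
    obtain M' where "M = mset M'" using ex_mset by metis
    then show ?thesis using kauffman_bracket_local[OF 2(1) inv _ wf] 2 by blast
  qed
qed

section \<open>Coherent orientation of planar diagrams\<close>

text \<open>In a functional relation two forward paths from one point run along each other. Hence a
  zigzag that ends at a point without successor can be pulled straight into a forward path.\<close>

lemma conn_sink:
  assumes sv: "single_valued r" and "(x, u) \<in> conn r" and u: "u \<notin> Domain r"
  shows "(x, u) \<in> r\<^sup>*"
proof -
  have "(u, x) \<in> conn r" using assms(2) by (rule conn_sym)
  then show ?thesis
  proof (induction rule: conn_induct)
    case base
    show ?case by simp
  next
    case (step b c)
    from step(2) show ?case
    proof
      assume bc: "(b, c) \<in> r"
      then have "b \<noteq> u" using u by blast
      with step(3) obtain b' where "(b, b') \<in> r" "(b', u) \<in> r\<^sup>*" by (metis converse_rtranclE)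
      with bc sv show ?thesis by (metis single_valuedD)
    next
      assume "(c, b) \<in> r"
      with step(3) show ?thesis by simp
    qed
  qed
qed

text \<open>
  The components of a partial permutation are cycles and paths; here the paths start and end at the
  points where the relation or its converse is undefined.
\<close>

lemma partial_permutation_ends:
  assumes fin: "finite L" and r: "r \<subseteq> L \<times> L" "single_valued r" "single_valued (r\<inverse>)"
    and uvwz: "u \<in> L" "v \<in> L" "w \<in> L" "z \<in> L" "u \<noteq> v" "w \<noteq> z"
    and dom: "Domain r = L - {u, v}" and ran: "Range r = L - {w, z}"
  shows "(u, v) \<notin> conn r \<and>
    ((u, w) \<in> conn r \<and> (v, z) \<in> conn r \<or> (u, z) \<in> conn r \<and> (v, w) \<in> conn r)"
proof -
  have uv: "(u, v) \<notin> conn r"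
  proof
    assume "(u, v) \<in> conn r"
    then have "(u, v) \<in> r\<^sup>*" using conn_sink[OF r(2)] dom by blast
    then show False
    proof (cases rule: converse_rtranclE)
      case base
      then show False using uvwz by simp
    next
      case (step y)
      then show False using dom by blast
    qed
  qed
  have one: "(x, w) \<in> conn r \<longleftrightarrow> (x, z) \<notin> conn r" if x: "x \<in> {u, v}" for x
  proof -
    \<comment> \<open>The edges inside the component \<open>K\<close> of \<open>x\<close> are
      counted by their sources and by their targets. All of \<open>K\<close> but \<open>x\<close>
      are sources and all but \<open>w\<close> and \<open>z\<close> are targets, so \<open>K\<close>
      contains exactly one of \<open>w\<close> and \<open>z\<close>.\<close>
    define K where "K = {y \<in> L. (x, y) \<in> conn r}"
    have K: "finite K" "x \<in> K" using fin x uvwz by (auto simp: K_def)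
    let ?R = "{e \<in> r. fst e \<in> K}"
    have closed: "a \<in> K \<longleftrightarrow> b \<in> K" if "(a, b) \<in> r" for a b
    proof -
      have "(x, a) \<in> conn r \<longleftrightarrow> (x, b) \<in> conn r"
        using conn_edge[OF that] conn_sym conn_trans by metis
      then show ?thesis using that r(1) by (auto simp: K_def)
    qed
    have "fst ` ?R = K - {x}"
    proof -
      have "fst ` ?R = K \<inter> Domain r" by force
      also have "\<dots> = K - {x}" using uv conn_sym[of v u r] x dom by (auto simp: K_def)
      finally show ?thesis .
    qed
    moreover have "snd ` ?R = K - {w, z}"
    proof -
      have "snd ` ?R = K \<inter> Range r" using closed by force
      also have "\<dots> = K - {w, z}" using ran by (auto simp: K_def)
      finally show ?thesis .
    qed
    moreover have "inj_on fst ?R" "inj_on snd ?R"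
      using r(2,3) by (auto simp: inj_on_def single_valued_def)
    then have "card (fst ` ?R) = card ?R" "card (snd ` ?R) = card ?R" by (simp_all add: card_image)
    ultimately have "card (K - {x}) = card (K - {w, z})" by simp
    moreover have "card (K - {w, z}) = card K - card (K \<inter> {w, z})" by (rule card_Diff_subset_Int) (use K in simp)
    moreover have "card (K \<inter> {w, z}) \<le> card K" "card (K - {x}) = card K - 1" "0 < card K"
      using K by (auto intro: card_mono simp: card_gt_0_iff)
    ultimately have "card (K \<inter> {w, z}) = 1" by linarith
    then have "w \<in> K \<longleftrightarrow> z \<notin> K"
      using \<open>w \<noteq> z\<close> by (cases "w \<in> K"; cases "z \<in> K") (simp_all add: Int_insert_right)
    then show ?thesis using uvwz by (simp add: K_def)
  qed
  have "\<not> ((u, y) \<in> conn r \<and> (v, y) \<in> conn r)" for y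
    using uv conn_sym conn_trans by metis
  then show ?thesis using uv one[of u] one[of v] by blast
qed

section \<open>Sets as vectors over the field with two elements\<close>

lemma odd_card_sym_diff:
  assumes "finite S" "finite T"
  shows "odd (card (sym_diff S T)) \<longleftrightarrow> odd (card S) \<noteq> odd (card T)"
proof -
  have "card (sym_diff S T) = card (S - T) + card (T - S)"
    using assms by (intro card_Un_disjoint) auto
  moreover have "card S = card (S - T) + card (S \<inter> T)" "card T = card (T - S) + card (S \<inter> T)"
    using assms card_Diff_subset_Int[of S T] card_Diff_subset_Int[of T S] card_mono[of S "S \<inter> T"]
      card_mono[of T "S \<inter> T"] by (auto simp: Int_commute)
  ultimately show ?thesis by auto
qed

text \<open>Adding \<open>T\<close> carries the fibre of \<open>f\<close> through \<open>T\<close>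
  onto the kernel, so all fibres have the size of the kernel. With \<open>sym_diff\<close> as
  addition this is the dimension formula for linear maps.\<close>

lemma card_kernel_image:
  assumes "finite G" and sd: "\<And>S T. S \<in> G \<Longrightarrow> T \<in> G \<Longrightarrow> sym_diff S T \<in> G"
    and hom: "\<And>S T. S \<in> G \<Longrightarrow> T \<in> G \<Longrightarrow> f (sym_diff S T) = sym_diff (f S) (f T)"
  shows "card G = card {S \<in> G. f S = {}} * card (f ` G)"
proof -
  have "card {S \<in> G. f S = f T} = card {S \<in> G. f S = {}}" if T: "T \<in> G" for T
  proof (rule bij_betw_same_card[of "\<lambda>S. sym_diff S T"])
    have inv: "sym_diff (sym_diff S T) T = S" for S by blast
    show "bij_betw (\<lambda>S. sym_diff S T) {S \<in> G. f S = f T} {S \<in> G. f S = {}}"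
      by (rule bij_betw_byWitness[where f' = "\<lambda>S. sym_diff S T"])
        (use inv sd[OF _ T] hom[OF _ T] in auto)
  qed
  moreover have "card G = (\<Sum>y\<in>f ` G. card {S \<in> G. f S = y})"
    using sum.image_gen[OF assms(1), of "\<lambda>_. 1 :: nat" f] by simp
  moreover have "(\<Sum>y\<in>f ` G. card {S \<in> G. f S = y}) = (\<Sum>y\<in>f ` G. card {S \<in> G. f S = {}})"
    using calculation(1) by (intro sum.cong) auto
  ultimately show ?thesis by simp
qed

section \<open>Darts, edges and faces of a code\<close>

definition dart_label :: "code \<Rightarrow> nat \<times> nat \<Rightarrow> nat" where
  "dart_label D d = ends (D ! fst d) ! snd d"

definition turn :: "code \<Rightarrow> nat \<times> nat \<Rightarrow> nat \<times> nat" where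
  "turn D d = (fst d, Suc (snd d) mod length (ends (D ! fst d)))"

lemma finite_darts: "finite (darts D)"
proof -
  have "darts D = Sigma {..<length D} (\<lambda>i. {..<length (ends (D ! i))})" by (auto simp: darts_def)
  then show ?thesis by simp
qed

lemma dart_label_in: "d \<in> darts D \<Longrightarrow> dart_label D d \<in> set_tile (D ! fst d)"
  by (auto simp: darts_def dart_label_def simp flip: set_ends)

lemma dart_label_in_labels: "d \<in> darts D \<Longrightarrow> dart_label D d \<in> labels D"
  using dart_label_in[of d D] by (fastforce simp: darts_def labels_def)

lemma ex_dart: "i < length D \<Longrightarrow> l \<in> set_tile (D ! i) \<Longrightarrow> \<exists>k. (i, k) \<in> darts D \<and> dart_label D (i, k) = l"
  by (force simp: darts_def dart_label_def in_set_conv_nth simp flip: set_ends)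

lemma occurrences_darts: "occurrences D l = card {d \<in> darts D. dart_label D d = l}"
proof -
  have "occurrences D l = (\<Sum>i<length D. count_list (ends (D ! i)) l)"
    unfolding occurrences_def
    by (induction D) (simp_all add: sum.lessThan_Suc_shift del: sum.lessThan_Suc)
  also have "\<dots> = (\<Sum>i<length D. card {k. k < length (ends (D ! i)) \<and> ends (D ! i) ! k = l})"
    by (simp add: count_list_eq_length_filter length_filter_conv_card eq_commute)
  also have "\<dots> = card (Sigma {..<length D} (\<lambda>i. {k. k < length (ends (D ! i)) \<and> ends (D ! i) ! k = l}))"
    by simp
  also have "Sigma {..<length D} (\<lambda>i. {k. k < length (ends (D ! i)) \<and> ends (D ! i) ! k = l}) =
      {d \<in> darts D. dart_label D d = l}"
    by (auto simp: darts_def dart_label_def)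
  finally show ?thesis .
qed

lemma edge_darts:
  assumes "well_formed D" and "d \<in> darts D"
  obtains e where "e \<in> darts D" "e \<noteq> d" "{x \<in> darts D. dart_label D x = dart_label D d} = {d, e}"
proof -
  have "card {x \<in> darts D. dart_label D x = dart_label D d} = 2"
    using assms dart_label_in_labels[of d D] by (simp add: well_formed_iff occurrences_darts)
  then obtain e e' where e: "{x \<in> darts D. dart_label D x = dart_label D d} = {e, e'}" "e \<noteq> e'"
    by (meson card_2_iff)
  then have "d \<in> {e, e'}" using assms(2) by blast
  then show ?thesis using that e by blast
qed

lemma turn_in_darts: "d \<in> darts D \<Longrightarrow> turn D d \<in> darts D"
  by (auto simp: darts_def turn_def intro: mod_less_divisor)

lemma face_step_iff:
  "(d, e) \<in> face_step D \<longleftrightarrow> (\<exists>x. d \<in> darts D \<and> x \<in> darts D \<and> d \<noteq> x \<and>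
     dart_label D d = dart_label D x \<and> e = turn D x)"
  by (cases d; cases e) (auto simp: face_step_def turn_def dart_label_def)

lemma turn_induct:
  assumes "(i, k) \<in> darts D" "(i, m) \<in> darts D" and "P (i, k)"
    and "\<And>d. d \<in> darts D \<Longrightarrow> P d \<Longrightarrow> P (turn D d)"
  shows "P (i, m)"
proof -
  let ?n = "length (ends (D ! i))"
  have lt: "k < ?n" "m < ?n" "i < length D" using assms by (auto simp: darts_def)
  have "P (i, (k + j) mod ?n)" for j
  proof (induction j)
    case 0
    show ?case using assms(3) lt by simp
  next
    case (Suc j)
    have "(i, (k + j) mod ?n) \<in> darts D" using lt by (auto simp: darts_def intro: mod_less_divisor)
    from assms(4)[OF this Suc] show ?case by (simp add: turn_def mod_Suc_eq)
  qed
  \<comment> \<open>From end \<open>k\<close>, \<open>?n - k\<close> turns lead to end 0 and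
    \<open>m\<close> further ones to end \<open>m\<close>; this also works if
    \<open>m < k\<close>.\<close>
  from this[of "?n - k + m"] show ?thesis using lt by simp
qed

lemma face_step_subset: "face_step D \<subseteq> darts D \<times> darts D"
  using turn_in_darts by (auto simp: face_step_iff)

lemma planar_orientation:
  assumes wf: "well_formed D" and "planar D"
  obtains S where "S \<subseteq> darts D"
    and "\<And>d e. d \<in> darts D \<Longrightarrow> e \<in> darts D \<Longrightarrow> d \<noteq> e \<Longrightarrow> dart_label D d = dart_label D e \<Longrightarrow>
      d \<in> S \<longleftrightarrow> e \<notin> S"
    and "\<And>d. d \<in> darts D \<Longrightarrow> turn D d \<in> S \<longleftrightarrow> d \<notin> S"
proof -
  \<comment> \<open>Over the field with two elements, \<open>f\<close> and \<open>g\<close> are the maps from sets of faces to sets of edges and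
    from sets of edges to sets of vertices.  Counting with Euler's formula shows that the sequence is
    exact at the edges; the set of all edges is in the kernel of \<open>g\<close> since all degrees are even, and a
    preimage of it is a checkerboard colouring.\<close>
  define G where "G = {S. S \<subseteq> darts D \<and> (\<forall>(a, b)\<in>face_step D. a \<in> S \<longleftrightarrow> b \<in> S)}"
  define f where "f S = {l \<in> labels D. odd (card {d \<in> S. dart_label D d = l})}" for S
  define g where "g Z = {i. i < length D \<and> odd (card {k. k < length (ends (D ! i)) \<and> ends (D ! i) ! k \<in> Z})}"
    for Z
  define C where "C = num_connected_parts D"
  define \<rho> where "\<rho> = (\<Union>t\<in>set D. set_tile t \<times> set_tile t)"
  have C: "C = num_classes (labels D) \<rho>" by (simp add: C_def \<rho>_def num_connected_parts_def)
  have fin: "finite (darts D)" "finite (labels D)" by (simp_all add: finite_darts finite_labels)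
  have finG: "finite G" by (rule finite_subset[of _ "Pow (darts D)"]) (use fin in \<open>auto simp: G_def\<close>)

  have step: "(\<forall>(a, b)\<in>face_step D. a \<in> S \<longleftrightarrow> b \<in> S) \<longleftrightarrow>
      (\<forall>d\<in>darts D. \<forall>x\<in>darts D. d \<noteq> x \<longrightarrow> dart_label D d = dart_label D x \<longrightarrow> (d \<in> S \<longleftrightarrow> turn D x \<in> S))" for S
  proof -
    have "(\<forall>(a, b)\<in>face_step D. a \<in> S \<longleftrightarrow> b \<in> S) \<longleftrightarrow>
        (\<forall>a b. (a, b) \<in> face_step D \<longrightarrow> (a \<in> S \<longleftrightarrow> b \<in> S))" by blast
    then show ?thesis unfolding face_step_iff by blast
  qed

  have pair: "card {d \<in> S. dart_label D d = l} = of_bool (d \<in> S) + of_bool (e \<in> S)"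
    if "{x \<in> darts D. dart_label D x = l} = {d, e}" "d \<noteq> e" "S \<subseteq> darts D" for S l d e
  proof -
    have "{x \<in> S. dart_label D x = l} = S \<inter> {d, e}" using that by blast
    then show ?thesis using that(2) by (simp add: Int_insert_right)
  qed
  \<comment> \<open>The two darts of an edge belong to the faces on its two sides, so
    \<open>f S\<close> consists of the edges whose sides differ in colour.\<close>
  have f_iff: "dart_label D d \<in> f S \<longleftrightarrow> (d \<in> S \<longleftrightarrow> e \<notin> S)"
    if "d \<in> darts D" "e \<in> darts D" "d \<noteq> e" "dart_label D d = dart_label D e" "S \<subseteq> darts D" for d e S
  proof -
    obtain e' where "{x \<in> darts D. dart_label D x = dart_label D d} = {d, e'}"
      using edge_darts[OF wf \<open>d \<in> darts D\<close>] by metis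
    moreover have "e \<in> {x \<in> darts D. dart_label D x = dart_label D d}" using that by simp
    ultimately have "{x \<in> darts D. dart_label D x = dart_label D d} = {d, e}" using that(3) by auto
    from pair[OF this that(3,5)] show ?thesis
      using dart_label_in_labels[OF that(1)] by (simp add: f_def)
  qed

  have hom_f: "f (sym_diff S T) = sym_diff (f S) (f T)" if "S \<in> G" "T \<in> G" for S T
  proof -
    have "finite {d \<in> S. dart_label D d = l}" "finite {d \<in> T. dart_label D d = l}" for l
      using that fin(1) by (auto simp: G_def intro: finite_subset)
    moreover have "{d \<in> sym_diff S T. dart_label D d = l} =
        sym_diff {d \<in> S. dart_label D d = l} {d \<in> T. dart_label D d = l}" for l by blast
    ultimately show ?thesis by (auto simp: f_def odd_card_sym_diff)
  qed
  have hom_g: "g (sym_diff Z W) = sym_diff (g Z) (g W)" for Z W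
  proof -
    have "{k. k < n \<and> h k \<in> sym_diff Z W} = sym_diff {k. k < n \<and> h k \<in> Z} {k. k < n \<and> h k \<in> W}"
      for n :: nat and h by blast
    then show ?thesis by (auto simp: g_def odd_card_sym_diff)
  qed
  have other: "\<exists>e\<in>darts D. e \<noteq> d \<and> dart_label D e = dart_label D d" if "d \<in> darts D" for d
    using edge_darts[OF wf that] by blast
  \<comment> \<open>The face step from \<open>e\<close> goes along the edge to \<open>d\<close> and
    arrives at \<open>turn D d\<close>.\<close>
  have turn_iff: "turn D d \<in> S \<longleftrightarrow> e \<in> S"
    if "S \<in> G" "d \<in> darts D" "e \<in> darts D" "d \<noteq> e" "dart_label D d = dart_label D e" for S d e
    using that step[of S] unfolding G_def by (metis (mono_tags, lifting) mem_Collect_eq)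

  \<comment> \<open>If no edge has differently coloured sides, the colour is constant around every
    tile and along every edge, hence on each connected part.\<close>
  have kernel_f: "card {S \<in> G. f S = {}} \<le> 2 ^ C"
  proof -
    have same: "d \<in> S \<longleftrightarrow> e \<in> S"
      if "S \<in> G" "f S = {}" "d \<in> darts D" "e \<in> darts D" "dart_label D d = dart_label D e" for S d e
    proof (cases "d = e")
      case False
      then show ?thesis using f_iff[of d e S] that by (auto simp: G_def)
    qed simp
    have turn: "turn D d \<in> S \<longleftrightarrow> d \<in> S" if "S \<in> G" "f S = {}" "d \<in> darts D" for S d
      using other[OF that(3)] turn_iff[OF that(1,3)] same[OF that(1,2,3)] by metis
    have sat: "b \<in> dart_label D ` S"
      if S: "S \<in> G" "f S = {}" and "(a, b) \<in> \<rho>" and a: "a \<in> dart_label D ` S" for S a b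
    proof -
      obtain i where i: "i < length D" "a \<in> set_tile (D ! i)" "b \<in> set_tile (D ! i)"
        using \<open>(a, b) \<in> \<rho>\<close> by (auto simp: \<rho>_def in_set_conv_nth)
      obtain k m where km: "(i, k) \<in> darts D" "dart_label D (i, k) = a"
        "(i, m) \<in> darts D" "dart_label D (i, m) = b"
        using i ex_dart by metis
      obtain d where d: "d \<in> S" "dart_label D d = a" using a by blast
      then have "d \<in> darts D" using S(1) by (auto simp: G_def)
      then have "(i, k) \<in> S" using same[OF S, of d "(i, k)"] d km by simp
      then have "(i, m) \<in> S"
        using turn_induct[of i k D m "\<lambda>x. x \<in> S"] km turn[OF S] by blast
      then show ?thesis using km by force
    qed
    have inj: "inj_on ((`) (dart_label D)) {S \<in> G. f S = {}}"
    proof (rule inj_onI)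
      have eq: "S = {d \<in> darts D. dart_label D d \<in> dart_label D ` S}" if "S \<in> {S \<in> G. f S = {}}" for S
      proof -
        have S: "S \<in> G" "f S = {}" "S \<subseteq> darts D" using that by (auto simp: G_def)
        show ?thesis using S(3) same[OF S(1,2)] by blast
      qed
      fix S T
      assume "S \<in> {S \<in> G. f S = {}}" "T \<in> {S \<in> G. f S = {}}" "dart_label D ` S = dart_label D ` T"
      then show "S = T" by (subst eq, simp, subst eq[of T]) simp_all
    qed
    have sub: "(`) (dart_label D) ` {S \<in> G. f S = {}} \<subseteq>
        {T. T \<subseteq> labels D \<and> (\<forall>(a, b)\<in>\<rho>. a \<in> T \<longleftrightarrow> b \<in> T)}"
    proof
      fix T assume "T \<in> (`) (dart_label D) ` {S \<in> G. f S = {}}"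
      then obtain S where S: "S \<in> G" "f S = {}" "T = dart_label D ` S" by blast
      then have "S \<subseteq> darts D" by (simp add: G_def)
      then have "T \<subseteq> labels D" using dart_label_in_labels by (auto simp: S(3))
      moreover have "a \<in> T \<longleftrightarrow> b \<in> T" if ab: "(a, b) \<in> \<rho>" for a b
      proof -
        have "(b, a) \<in> \<rho>" using ab by (auto simp: \<rho>_def)
        then show ?thesis using sat[OF S(1,2)] ab S(3) by metis
      qed
      ultimately show "T \<in> {T. T \<subseteq> labels D \<and> (\<forall>(a, b)\<in>\<rho>. a \<in> T \<longleftrightarrow> b \<in> T)}" by blast
    qed
    have fin': "finite {T. T \<subseteq> labels D \<and> (\<forall>(a, b)\<in>\<rho>. a \<in> T \<longleftrightarrow> b \<in> T)}"
      by (rule finite_subset[of _ "Pow (labels D)"]) (use fin(2) in auto)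
    have \<rho>: "\<rho> \<subseteq> labels D \<times> labels D" unfolding \<rho>_def labels_def by blast
    from card_inj_on_le[OF inj sub fin'] show ?thesis
      unfolding C card_saturated_subsets[OF fin(2) \<rho>] .
  qed

  \<comment> \<open>For an edge \<open>l\<close> between two tiles, \<open>g {l}\<close> is the pair
    of these tiles. Sums along paths give every pair of tiles in one connected part, so modulo the
    image of \<open>g\<close> each set of tiles reduces to a set of chosen tiles
    \<open>rep c\<close>, one for each part.\<close>
  have image_g: "2 ^ length D \<le> card (g ` Pow (labels D)) * 2 ^ C"
  proof -
    let ?B = "g ` Pow (labels D)"
    have B0: "{} \<in> ?B" by (rule image_eqI[of _ _ "{}"]) (simp_all add: g_def)
    have B_sd: "sym_diff b b' \<in> ?B" if "b \<in> ?B" "b' \<in> ?B" for b b'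
    proof -
      from that(1) obtain Z where Z: "b = g Z" "Z \<in> Pow (labels D)" by (rule imageE)
      from that(2) obtain W where W: "b' = g W" "W \<in> Pow (labels D)" by (rule imageE)
      have "sym_diff b b' = g (sym_diff Z W)" unfolding Z(1) W(1) by (rule hom_g[symmetric])
      moreover have "sym_diff Z W \<in> Pow (labels D)" using Z(2) W(2) by auto
      ultimately show ?thesis by (rule image_eqI)
    qed
    have share: "sym_diff {i} {j} \<in> ?B"
      if "i < length D" "j < length D" "l \<in> set_tile (D ! i)" "l \<in> set_tile (D ! j)" for i j l
    proof (cases "i = j")
      case True
      then show ?thesis using B0 by simp
    next
      case False
      from ex_dart[OF that(1,3)] ex_dart[OF that(2,4)]
      obtain k m where km: "(i, k) \<in> darts D" "dart_label D (i, k) = l"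
        "(j, m) \<in> darts D" "dart_label D (j, m) = l"
        by blast
      obtain e where "e \<in> darts D" "e \<noteq> (i, k)"
          "{x \<in> darts D. dart_label D x = dart_label D (i, k)} = {(i, k), e}"
        by (rule edge_darts[OF wf km(1)])
      then have "{x \<in> darts D. dart_label D x = l} = {(i, k), e}" by (simp only: km(2))
      moreover have "(j, m) \<in> {x \<in> darts D. dart_label D x = l}" using km by simp
      ultimately have pr: "{x \<in> darts D. dart_label D x = l} = {(i, k), (j, m)}" using False by auto
      have "{k'. k' < length (ends (D ! i')) \<and> ends (D ! i') ! k' \<in> {l}} =
          (if i' = i then {k} else if i' = j then {m} else {})" if "i' < length D" for i'
      proof -
        have "{k'. k' < length (ends (D ! i')) \<and> ends (D ! i') ! k' \<in> {l}} =
            {k'. (i', k') \<in> {x \<in> darts D. dart_label D x = l}}"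
          using that by (auto simp: darts_def dart_label_def)
        then show ?thesis unfolding pr using False by auto
      qed
      then have "g {l} = sym_diff {i} {j}"
        using that False by (auto simp: g_def split: if_splits)
      moreover have "l \<in> labels D" using that by (auto simp: labels_def)
      ultimately show ?thesis by (intro image_eqI[of _ _ "{l}"]) auto
    qed
    have link: "\<forall>j<length D. m \<in> set_tile (D ! j) \<longrightarrow> sym_diff {i} {j} \<in> ?B"
      if "i < length D" "l \<in> set_tile (D ! i)" "(l, m) \<in> conn \<rho>" for i l m
      using that(3)
    proof (induction rule: conn_induct)
      case base
      show ?case using share that(1,2) by blast
    next
      case (step b c)
      then obtain n where n: "n < length D" "b \<in> set_tile (D ! n)" "c \<in> set_tile (D ! n)"
        by (auto simp: \<rho>_def in_set_conv_nth)
      show ?case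
      proof (intro allI impI)
        fix j assume j: "j < length D" "c \<in> set_tile (D ! j)"
        have "sym_diff {i} {n} \<in> ?B" "sym_diff {n} {j} \<in> ?B"
          using step.IH n share[OF n(1) j(1) n(3) j(2)] by blast+
        from B_sd[OF this] have "sym_diff (sym_diff {i} {n}) (sym_diff {n} {j}) \<in> ?B" .
        moreover have "sym_diff (sym_diff {i} {n}) (sym_diff {n} {j}) = sym_diff {i} {j}" by blast
        ultimately show "sym_diff {i} {j} \<in> ?B" by simp
      qed
    qed
    have "\<exists>j<length D. set_tile (D ! j) \<inter> c \<noteq> {}" if "c \<in> labels D // conn \<rho>" for c
    proof -
      from that obtain l where "l \<in> labels D" "c = conn \<rho> `` {l}" by (auto elim: quotientE)
      moreover then obtain j where "j < length D" "l \<in> set_tile (D ! j)"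
        by (auto simp: labels_def in_set_conv_nth)
      ultimately show ?thesis using conn_refl[of l \<rho>] by blast
    qed
    then obtain rep where rep: "rep c < length D" "set_tile (D ! rep c) \<inter> c \<noteq> {}"
      if "c \<in> labels D // conn \<rho>" for c by metis
    let ?T = "rep ` (labels D // conn \<rho>)"
    have finQ: "finite (labels D // conn \<rho>)" using fin(2) by (simp add: quotient_def)
    have span: "S \<in> (\<lambda>(b, t). sym_diff b t) ` (?B \<times> Pow ?T)" if "finite S" "S \<subseteq> {..<length D}" for S
      using that
    proof (induction S)
      case empty
      show ?case by (rule image_eqI[of _ _ "({}, {})"]) (use B0 in auto)
    next
      case (insert i S)
      then obtain b t where bt: "S = sym_diff b t" "b \<in> ?B" "t \<subseteq> ?T" by auto
      have i: "i < length D" using insert by simp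
      obtain l where l: "l \<in> set_tile (D ! i)" by (cases "D ! i") auto
      then have "l \<in> labels D" using i by (auto simp: labels_def)
      then have c: "conn \<rho> `` {l} \<in> labels D // conn \<rho>" by (rule quotientI)
      define j where "j = rep (conn \<rho> `` {l})"
      obtain m where m: "m \<in> set_tile (D ! j)" "(l, m) \<in> conn \<rho>" using rep(2)[OF c] by (auto simp: j_def)
      have "j < length D" "j \<in> ?T" using rep(1)[OF c] c by (auto simp: j_def)
      then have "sym_diff {i} {j} \<in> ?B" using link[OF i l m(2)] m(1) by blast
      from B_sd[OF bt(2) this] have "sym_diff b (sym_diff {i} {j}) \<in> ?B" .
      moreover have "sym_diff t {j} \<in> Pow ?T" using bt(3) \<open>j \<in> ?T\<close> by blast
      moreover have "insert i S = sym_diff (sym_diff b (sym_diff {i} {j})) (sym_diff t {j})"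
        using insert.hyps(2) unfolding bt(1) by blast
      ultimately show ?case
        by (intro image_eqI[of _ _ "(sym_diff b (sym_diff {i} {j}), sym_diff t {j})"])
          (simp_all only: case_prod_conv mem_Sigma_iff)
    qed
    have sub: "Pow {..<length D} \<subseteq> (\<lambda>(b, t). sym_diff b t) ` (?B \<times> Pow ?T)"
    proof
      fix S assume "S \<in> Pow {..<length D}"
      then have S: "S \<subseteq> {..<length D}" by simp
      show "S \<in> (\<lambda>(b, t). sym_diff b t) ` (?B \<times> Pow ?T)"
        by (rule span[OF finite_subset[OF S finite_lessThan] S])
    qed
    have finBT: "finite (?B \<times> Pow ?T)" using fin(2) finQ by simp
    have "card (Pow {..<length D}) \<le> card (?B \<times> Pow ?T)"
      using card_mono[OF finite_imageI[OF finBT] sub] card_image_le[OF finBT] by (rule le_trans)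
    also have "\<dots> = card ?B * 2 ^ card ?T" using finQ by (simp add: card_cartesian_product card_Pow)
    also have "\<dots> \<le> card ?B * 2 ^ C"
      using card_image_le[OF finQ, of rep] by (simp add: C num_classes_conn)
    finally show ?thesis by (simp add: card_Pow)
  qed

  \<comment> \<open>The sides of the edge at end \<open>k\<close> have the colours of the darts
    \<open>k\<close> and \<open>k + 1\<close>, and on the way around a tile the colour changes an
    even number of times. Tiles have 2 or 4 ends, so this is a finite check.\<close>
  have gf: "g (f S) = {}" if S: "S \<in> G" for S
  proof -
    have "even (card {k. k < length (ends (D ! i)) \<and> ends (D ! i) ! k \<in> f S})" if i: "i < length D" for i
    proof -
      let ?n = "length (ends (D ! i))"
      have "ends (D ! i) ! k \<in> f S \<longleftrightarrow> ((i, k) \<in> S) \<noteq> ((i, Suc k mod ?n) \<in> S)" if "k < ?n" for k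
      proof -
        have d: "(i, k) \<in> darts D" using i that by (simp add: darts_def)
        then obtain e where e: "e \<in> darts D" "(i, k) \<noteq> e" "dart_label D (i, k) = dart_label D e"
          using other by metis
        show ?thesis
          using f_iff[OF d e, of S] turn_iff[OF S d e] S by (auto simp: dart_label_def turn_def G_def)
      qed
      then have "{k. k < ?n \<and> ends (D ! i) ! k \<in> f S} =
          {k. k < ?n \<and> ((i, k) \<in> S) \<noteq> ((i, Suc k mod ?n) \<in> S)}" by blast
      moreover have "even (card {k. k < n \<and> P k \<noteq> P (Suc k mod n)})" if "n = 2 \<or> n = 4"
        for n and P :: "nat \<Rightarrow> bool"
      proof -
        have "card {k. k < n \<and> P k \<noteq> P (Suc k mod n)} = length (filter (\<lambda>k. P k \<noteq> P (Suc k mod n)) [0..<n])"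
          by (simp add: length_filter_conv_card cong: conj_cong)
        moreover have "even (length (filter (\<lambda>k. P k \<noteq> P (Suc k mod n)) [0..<n]))"
        proof -
          have "[0..<2] = [0, 1::nat]" "[0..<4] = [0, 1, 2, 3::nat]" by (simp_all add: upt_rec)
          moreover have "Suc 0 mod 2 = 1" "Suc 1 mod 2 = 0" "Suc 0 mod 4 = 1" "Suc 1 mod 4 = 2"
            "Suc 2 mod 4 = 3" "Suc 3 mod 4 = 0" by simp_all
          ultimately show ?thesis using that by (auto simp del: One_nat_def)
        qed
        ultimately show ?thesis by simp
      qed
      moreover have "?n = 2 \<or> ?n = 4" by (cases "D ! i") auto
      ultimately show ?thesis by simp
    qed
    then show ?thesis by (auto simp: g_def)
  qed
  have sd_G: "sym_diff S T \<in> G" if "S \<in> G" "T \<in> G" for S T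
    using that unfolding G_def by blast
  have card_G: "2 ^ num_faces D = card {S \<in> G. f S = {}} * card (f ` G)"
    using card_kernel_image[OF finG sd_G hom_f] card_saturated_subsets[OF fin(1) face_step_subset]
    by (simp add: G_def num_faces_def)
  have card_labels: "2 ^ card (labels D) =
      card {Z \<in> Pow (labels D). g Z = {}} * card (g ` Pow (labels D))"
    using card_kernel_image[of "Pow (labels D)" g] hom_g fin(2) by (auto simp: card_Pow)
  have "labels D \<in> f ` G"
  proof -
    let ?Z = "{Z \<in> Pow (labels D). g Z = {}}"
    have "num_faces D + length D = card (labels D) + 2 * C"
      using \<open>planar D\<close> by (simp add: planar_def C_def)
    \<comment> \<open>In powers of two, Euler's formula combines the bounds \<open>kernel_f\<close>
      and \<open>image_g\<close> into a bound of the kernel of \<open>g\<close> by the size of the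
      image of \<open>f\<close>: both bounds lose a factor \<open>2 ^ C\<close>, which accounts for
      the summand \<open>2 * C\<close>. The opposite inclusion is \<open>gf\<close>.\<close>
    then have "2 ^ card (labels D) * 2 ^ (2 * C) = (2 ^ num_faces D * 2 ^ length D :: nat)"
      by (metis power_add)
    then have "card ?Z * card (g ` Pow (labels D)) * 2 ^ (2 * C) = 2 ^ num_faces D * 2 ^ length D"
      by (simp only: card_labels)
    also have "\<dots> \<le> (2 ^ C * card (f ` G)) * (card (g ` Pow (labels D)) * 2 ^ C)"
      unfolding card_G using kernel_f image_g by (intro mult_mono) auto
    also have "\<dots> = card (f ` G) * card (g ` Pow (labels D)) * 2 ^ (2 * C)"
      by (simp add: mult_2 power_add)
    finally have "card ?Z * card (g ` Pow (labels D)) \<le> card (f ` G) * card (g ` Pow (labels D))" by simp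
    moreover have "0 < card (g ` Pow (labels D))" using fin(2) by (auto simp: card_gt_0_iff)
    ultimately have "card ?Z \<le> card (f ` G)" by simp
    moreover have "f ` G \<subseteq> ?Z" using gf by (auto simp: f_def)
    moreover have "finite ?Z" using fin(2) by simp
    ultimately have "f ` G = ?Z" by (meson card_seteq)
    moreover have "even (length (ends t))" for t :: "nat tile" by (cases t) auto
    then have "g (labels D) = {}"
    proof -
      have "{k. k < length (ends (D ! i)) \<and> ends (D ! i) ! k \<in> labels D} = {..<length (ends (D ! i))}"
        if "i < length D" for i
        using that by (auto simp: labels_def simp flip: set_ends intro: nth_mem)
      then show ?thesis using \<open>\<And>t. even (length (ends t))\<close> by (auto simp: g_def)
    qed
    ultimately show ?thesis by simp
  qed
  \<comment> \<open>Now each edge separates a black face from a white one, so exactly one of its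
    darts is in \<open>S\<close>.\<close>
  then obtain S where S: "S \<in> G" "f S = labels D" by blast
  have opp: "d \<in> S \<longleftrightarrow> e \<notin> S"
    if "d \<in> darts D" "e \<in> darts D" "d \<noteq> e" "dart_label D d = dart_label D e" for d e
    using f_iff[OF that, of S] S dart_label_in_labels[OF that(1)] by (simp add: G_def)
  have "turn D d \<in> S \<longleftrightarrow> d \<notin> S" if d: "d \<in> darts D" for d
  proof -
    obtain e where e: "e \<in> darts D" "e \<noteq> d" "dart_label D e = dart_label D d"
      using edge_darts[OF wf d] by blast
    then have "turn D d \<in> S \<longleftrightarrow> e \<in> S" using turn_iff[OF S(1) d] by metis
    then show ?thesis using opp[of d e] e d by simp
  qed
  then show ?thesis using that opp S(1) by (auto simp: G_def)
qed

text \<open>Strands are followed by the positions of ends and not by labels, because two ends of the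
  same tile may carry the same label.\<close>

fun mate :: "splice \<Rightarrow> 'l tile \<Rightarrow> nat \<Rightarrow> nat" where
  "mate A (RealX a b c d) k = [1, 0, 3, 2] ! k"
| "mate B (RealX a b c d) k = [3, 2, 1, 0] ! k"
| "mate s (VirtX a b c d) k = [2, 3, 0, 1] ! k"
| "mate s (Arc a b) k = [1, 0] ! k"

lemma ends_index: "k < length (ends t) \<Longrightarrow> k = 0 \<or> k = 1 \<or> k = 2 \<or> k = 3"
  by (cases t) auto

lemma mate_less: "k < length (ends t) \<Longrightarrow> mate s t k < length (ends t)"
  using ends_index[of k t] by (cases t; cases s) auto

lemma mate_mate: "k < length (ends t) \<Longrightarrow> mate s t (mate s t k) = k"
  using ends_index[of k t] by (cases t; cases s) auto

text \<open>Splices and arcs join neighbouring ends, of opposite parity, whereas a virtual crossing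
  joins opposite ends. This is where the absence of virtual crossings enters.\<close>

lemma even_mate:
  "k < length (ends t) \<Longrightarrow> (\<forall>a b c d. t \<noteq> VirtX a b c d) \<Longrightarrow> even (mate s t k) \<longleftrightarrow> odd k"
  using ends_index[of k t] by (cases t; cases s) auto

lemma mate_strand:
  "k < length (ends t) \<Longrightarrow>
    (ends t ! k, ends t ! mate s t k) \<in> spliced_strands s t \<union> (spliced_strands s t)\<inverse>"
  using ends_index[of k t] by (cases t; cases s) auto

lemma strand_mate:
  assumes "(x, y) \<in> spliced_strands s t"
  shows "\<exists>k<length (ends t). x = ends t ! k \<and> y = ends t ! mate s t k"
proof -
  let ?P = "\<lambda>k. k < length (ends t) \<and> x = ends t ! k \<and> y = ends t ! mate s t k"
  have "?P 0 \<or> ?P 1 \<or> ?P 2"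
    using assms by (cases t; cases s) auto
  then show ?thesis by metis
qed

text \<open>
  Each edge has one dart in \<open>S\<close> and one outside.  Following the state from the former to the latter
  makes it a partial permutation of the edges, so the strands left by removing a crossing never join
  opposite ends of it.
\<close>

lemma crossing_connections:
  fixes s :: "nat \<Rightarrow> splice"
  assumes cl: "classical_diagram D" and p: "p < length D" "D ! p = RealX a b c d"
  defines "G \<equiv> \<Union>i\<in>{..<length D} - {p}. spliced_strands (s i) (D ! i)"
  shows "(a, c) \<notin> conn G \<and>
    ((a, b) \<in> conn G \<and> (c, d) \<in> conn G \<or> (a, d) \<in> conn G \<and> (b, c) \<in> conn G)"
proof -
  have wf: "well_formed D" and pl: "planar D" and nv: "VirtX a' b' c' d' \<notin> set D" for a' b' c' d'
    using cl by (simp_all add: classical_diagram_def virtual_diagram_def)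
  obtain S where S: "S \<subseteq> darts D"
    and opp: "\<And>d e. d \<in> darts D \<Longrightarrow> e \<in> darts D \<Longrightarrow> d \<noteq> e \<Longrightarrow> dart_label D d = dart_label D e \<Longrightarrow>
      d \<in> S \<longleftrightarrow> e \<notin> S"
    and turn: "\<And>d. d \<in> darts D \<Longrightarrow> turn D d \<in> S \<longleftrightarrow> d \<notin> S"
    using planar_orientation[OF wf pl] by metis
  let ?lab = "dart_label D"
  have alt: "(i, k) \<in> S \<longleftrightarrow> ((i, 0) \<in> S \<longleftrightarrow> even k)" if "(i, k) \<in> darts D" for i k
    using that
  proof (induction k)
    case (Suc k)
    then have "(i, k) \<in> darts D" "turn D (i, k) = (i, Suc k)" by (auto simp: darts_def turn_def)
    then show ?case using Suc turn[of "(i, k)"] by auto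
  qed simp
  define mt where "mt x = (fst x, mate (s (fst x)) (D ! fst x) (snd x))" for x
  have mt_darts: "mt x \<in> darts D" and mt_mt: "mt (mt x) = x" and mt_S: "mt x \<in> S \<longleftrightarrow> x \<notin> S"
    if x: "x \<in> darts D" for x
  proof -
    obtain i k where ik: "x = (i, k)" "i < length D" "k < length (ends (D ! i))"
      using x by (auto simp: darts_def)
    then show "mt x \<in> darts D" by (simp add: mt_def darts_def mate_less)
    then have "mt x \<in> S \<longleftrightarrow> ((i, 0) \<in> S \<longleftrightarrow> even (mate (s i) (D ! i) k))"
      using alt ik by (simp add: mt_def)
    moreover have "even (mate (s i) (D ! i) k) \<longleftrightarrow> odd k"
      using ik nv by (intro even_mate) (metis nth_mem)+
    ultimately show "mt x \<in> S \<longleftrightarrow> x \<notin> S" using alt[of i k] x ik by auto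
    show "mt (mt x) = x" using ik by (simp add: mt_def mate_mate)
  qed
  \<comment> \<open>Each label has one dart in \<open>S\<close> and one outside. The relation leaves
    a label through its dart in \<open>S\<close> and reaches the next label through the dart of the
    latter outside \<open>S\<close>. It is therefore injective and functional, and it breaks off
    only at darts of the tile \<open>p\<close>.\<close>
  define r where "r = {(?lab x, ?lab (mt x)) | x. x \<in> S \<and> fst x \<noteq> p}"
  have rI: "(?lab x, ?lab (mt x)) \<in> r" if "x \<in> S" "fst x \<noteq> p" for x
    using that unfolding r_def by blast
  have edge_unique: "x = y"
    if "x \<in> darts D" "y \<in> darts D" "x \<in> S \<longleftrightarrow> y \<in> S" "?lab x = ?lab y" for x y
    using opp[OF that(1,2)] that by blast
  have ex_dart_side: "\<exists>x\<in>darts D. ?lab x = l \<and> (x \<in> S \<longleftrightarrow> P)" if "l \<in> labels D" for l P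
  proof -
    from that obtain i where "i < length D" "l \<in> set_tile (D ! i)"
      by (auto simp: labels_def in_set_conv_nth)
    then obtain k where k: "(i, k) \<in> darts D" "?lab (i, k) = l" using ex_dart by metis
    obtain e where "e \<in> darts D" "e \<noteq> (i, k)" "?lab e = l"
      using edge_darts[OF wf k(1)] k(2) by blast
    then show ?thesis using opp[of e "(i, k)"] k by metis
  qed

  have rG: "r \<subseteq> conn G"
  proof
    fix e assume "e \<in> r"
    then obtain i k where e: "e = (?lab (i, k), ?lab (mt (i, k)))" "(i, k) \<in> S" "i \<noteq> p"
      by (auto simp: r_def)
    then have ik: "i < length D" "k < length (ends (D ! i))" using S by (auto simp: darts_def)
    have "spliced_strands (s i) (D ! i) \<subseteq> G" using ik e(3) by (auto simp: G_def)
    with mate_strand[OF ik(2), of "s i"] have "e \<in> G \<or> (snd e, fst e) \<in> G"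
      by (auto simp: e dart_label_def mt_def)
    then show "e \<in> conn G" using conn_edge conn_sym by (metis prod.collapse)
  qed
  have Gr: "G \<subseteq> conn r"
  proof
    fix e assume "e \<in> G"
    then obtain i where i: "i < length D" "i \<noteq> p" "e \<in> spliced_strands (s i) (D ! i)"
      by (auto simp: G_def)
    then obtain k where k: "k < length (ends (D ! i))" "e = (?lab (i, k), ?lab (mt (i, k)))"
      using strand_mate[of "fst e" "snd e" "s i" "D ! i"]
      by (metis dart_label_def fst_conv mt_def prod.collapse snd_conv)
    have ik: "(i, k) \<in> darts D" using i k by (simp add: darts_def)
    show "e \<in> conn r"
    proof (cases "(i, k) \<in> S")
      case True
      then have "e \<in> r" using k i by (auto simp: r_def)
      then show ?thesis by (metis conn_edge prod.collapse)
    next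
      case False
      then have "mt (i, k) \<in> S" "fst (mt (i, k)) \<noteq> p"
        using mt_S[OF ik] i by (simp_all add: mt_def)
      then have "(?lab (mt (i, k)), ?lab (i, k)) \<in> r"
        using rI[of "mt (i, k)"] mt_mt[OF ik] by simp
      then show ?thesis using k conn_edge conn_sym by metis
    qed
  qed
  have conn_eq: "(x, y) \<in> conn G \<longleftrightarrow> (x, y) \<in> conn r" for x y
    using conn_map[of x y G id r] conn_map[of x y r id G] rG Gr by auto

  have dom: "Domain r = labels D - {l. \<exists>x\<in>S. fst x = p \<and> ?lab x = l}"
  proof (intro equalityI subsetI)
    fix l assume "l \<in> Domain r"
    then obtain x where x: "x \<in> S" "fst x \<noteq> p" "l = ?lab x" by (auto simp: r_def)
    have "fst y \<noteq> p" if y: "y \<in> S" "?lab y = l" for y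
    proof -
      have "x \<in> darts D" "y \<in> darts D" using x y S by auto
      then have "x = y" using x y by (intro edge_unique) simp_all
      then show ?thesis using x(2) by blast
    qed
    then show "l \<in> labels D - {l. \<exists>x\<in>S. fst x = p \<and> ?lab x = l}"
      using x S dart_label_in_labels[of x D] by auto
  next
    fix l assume l: "l \<in> labels D - {l. \<exists>x\<in>S. fst x = p \<and> ?lab x = l}"
    then obtain x where x: "x \<in> S" "?lab x = l" using ex_dart_side[of l True] by auto
    then have "fst x \<noteq> p" using l by auto
    then show "l \<in> Domain r" using x rI[of x] by auto
  qed
  have ran: "Range r = labels D - {l. \<exists>x\<in>darts D - S. fst x = p \<and> ?lab x = l}"
  proof (intro equalityI subsetI)
    fix l assume "l \<in> Range r"
    then obtain x where x: "x \<in> S" "fst x \<noteq> p" "l = ?lab (mt x)" by (auto simp: r_def)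
    then have "mt x \<in> darts D" "mt x \<notin> S" "fst (mt x) \<noteq> p"
      using S mt_darts mt_S by (auto simp: mt_def)
    moreover have "fst y \<noteq> p" if y: "y \<in> darts D - S" "?lab y = l" for y
    proof -
      have "mt x = y" using edge_unique[of "mt x" y] x calculation y by simp
      then show ?thesis using calculation(3) by blast
    qed
    ultimately show "l \<in> labels D - {l. \<exists>x\<in>darts D - S. fst x = p \<and> ?lab x = l}"
      using x dart_label_in_labels[of "mt x" D] by auto
  next
    fix l assume l: "l \<in> labels D - {l. \<exists>x\<in>darts D - S. fst x = p \<and> ?lab x = l}"
    then obtain x where x: "x \<in> darts D" "x \<notin> S" "?lab x = l" using ex_dart_side[of l False] by auto
    then have "mt x \<in> S" "mt (mt x) = x" "fst (mt x) \<noteq> p"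
      using l mt_S mt_mt by (auto simp: mt_def)
    then show "l \<in> Range r" using x rI[of "mt x"] by auto
  qed
  have sv: "single_valued r" "single_valued (r\<inverse>)"
  proof -
    have "x = y" if "x \<in> S" "y \<in> S" "?lab x = ?lab y" for x y
      using that edge_unique S by blast
    then show "single_valued r" by (fastforce simp: single_valued_def r_def)
    have "x = y" if "x \<in> S" "y \<in> S" "?lab (mt x) = ?lab (mt y)" for x y
    proof -
      have xy: "x \<in> darts D" "y \<in> darts D" using that S by auto
      then have "mt x = mt y" using that mt_darts mt_S by (intro edge_unique) auto
      then show ?thesis using mt_mt xy by metis
    qed
    then show "single_valued (r\<inverse>)" by (fastforce simp: single_valued_def r_def)
  qed
  have sub: "r \<subseteq> labels D \<times> labels D" using dom ran by auto
  have dp: "(p, k) \<in> darts D \<longleftrightarrow> k = 0 \<or> k = 1 \<or> k = 2 \<or> k = 3" for k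
    using p by (auto simp: darts_def)
  have lp: "?lab (p, 0) = a" "?lab (p, 1) = b" "?lab (p, 2) = c" "?lab (p, 3) = d"
    using p by (auto simp: dart_label_def numeral_2_eq_2 numeral_3_eq_3)
  have inL: "a \<in> labels D" "b \<in> labels D" "c \<in> labels D" "d \<in> labels D"
    using lp dart_label_in_labels dp by metis+
  have side: "(p, 1) \<in> S \<longleftrightarrow> (p, 0) \<notin> S" "(p, 2) \<in> S \<longleftrightarrow> (p, 0) \<in> S" "(p, 3) \<in> S \<longleftrightarrow> (p, 0) \<notin> S"
    using alt[of p 1] alt[of p 2] alt[of p 3] dp by auto
  \<comment> \<open>Opposite ends of \<open>p\<close> are on the same side of \<open>S\<close>, so
    they cannot be the two darts of one edge. Neighbouring ends can, as in a curl.\<close>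
  have ne: "a \<noteq> c" "b \<noteq> d"
    using edge_unique[of "(p, 0)" "(p, 2)"] edge_unique[of "(p, 1)" "(p, 3)"] dp lp side by auto
  have at_p: "{l. \<exists>x\<in>T. fst x = p \<and> ?lab x = l} =
      {l. (p, 0) \<in> T \<and> l = a \<or> (p, 1) \<in> T \<and> l = b \<or> (p, 2) \<in> T \<and> l = c \<or> (p, 3) \<in> T \<and> l = d}"
    if T: "T \<subseteq> darts D" for T
  proof (intro equalityI subsetI)
    fix l assume "l \<in> {l. \<exists>x\<in>T. fst x = p \<and> ?lab x = l}"
    then obtain x where x: "x \<in> T" "fst x = p" "?lab x = l" by blast
    obtain k where "x = (p, k)" using x(2) by (cases x) simp
    then have k: "(p, k) \<in> T" "?lab (p, k) = l" using x by simp_all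
    then have "(p, k) \<in> darts D" using T by blast
    then have "k = 0 \<or> k = 1 \<or> k = 2 \<or> k = 3" by (simp only: dp)
    then show "l \<in> {l. (p, 0) \<in> T \<and> l = a \<or> (p, 1) \<in> T \<and> l = b \<or> (p, 2) \<in> T \<and> l = c \<or> (p, 3) \<in> T \<and> l = d}"
      using k lp by auto
  next
    fix l
    assume "l \<in> {l. (p, 0) \<in> T \<and> l = a \<or> (p, 1) \<in> T \<and> l = b \<or> (p, 2) \<in> T \<and> l = c \<or> (p, 3) \<in> T \<and> l = d}"
    then have "\<exists>k. (p, k) \<in> T \<and> ?lab (p, k) = l" using lp by blast
    then show "l \<in> {l. \<exists>x\<in>T. fst x = p \<and> ?lab x = l}" by force
  qed
  \<comment> \<open>Membership in \<open>S\<close> alternates around \<open>p\<close>: one opposite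
    pair of ends has no successor under \<open>r\<close>, and the other pair has no
    predecessor.\<close>
  have in_set: "{l. \<exists>x\<in>S. fst x = p \<and> ?lab x = l} = (if (p, 0) \<in> S then {a, c} else {b, d})"
    unfolding at_p[OF S] using side by auto
  have dp': "(p, 0) \<in> darts D" "(p, 1) \<in> darts D" "(p, 2) \<in> darts D" "(p, 3) \<in> darts D"
    using dp by simp_all
  have out_set: "{l. \<exists>x\<in>darts D - S. fst x = p \<and> ?lab x = l} = (if (p, 0) \<in> S then {b, d} else {a, c})"
    unfolding at_p[OF Diff_subset] using side dp' by auto
  show ?thesis
  proof (cases "(p, 0) \<in> S")
    case True
    then show ?thesis
      using partial_permutation_ends[OF finite_labels sub sv, of a c b d] dom ran in_set out_set inL ne
      unfolding conn_eq by (auto intro: conn_sym)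
  next
    case False
    then have *: "(b, d) \<notin> conn r \<and>
        ((b, a) \<in> conn r \<and> (d, c) \<in> conn r \<or> (b, c) \<in> conn r \<and> (d, a) \<in> conn r)"
      using partial_permutation_ends[OF finite_labels sub sv, of b d a c] dom ran in_set out_set inL ne
      by simp
    then have "(a, c) \<notin> conn r" using conn_sym conn_trans by metis
    then show ?thesis using * conn_sym unfolding conn_eq by metis
  qed
qed

section \<open>Numbers of circles of states\<close>

text \<open>Outside the crossing, \<open>a\<close> is joined to \<open>b\<close> and
  \<open>c\<close> to \<open>d\<close> in two separate classes. Repeating these connections changes
  nothing, and each of the other two ways to join the four ends merges the two classes.\<close>

lemma num_classes_crossing:
  assumes X: "finite X" "a \<in> X" "b \<in> X" "c \<in> X" "d \<in> X"
    and ab: "(a, b) \<in> conn r" and cd: "(c, d) \<in> conn r" and ac: "(a, c) \<notin> conn r"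
  shows "num_classes X (r \<union> {(a, b), (c, d)}) = num_classes X r"
    and "Suc (num_classes X (r \<union> {(a, d), (b, c)})) = num_classes X r"
    and "Suc (num_classes X (r \<union> {(a, c), (b, d)})) = num_classes X r"
proof -
  have mono: "(x, y) \<in> conn r \<Longrightarrow> (x, y) \<in> conn (insert e r)" for x y e
    using conn_mono[of x y r "insert e r"] by blast
  have bc: "(b, c) \<notin> conn r" using ab ac conn_trans by metis
  have eq: "r \<union> {e, e'} = insert e (insert e' r)" for e e' by auto
  show "num_classes X (r \<union> {(a, b), (c, d)}) = num_classes X r"
    unfolding eq using num_classes_insert_conn[OF mono[OF ab], of X] num_classes_insert_conn[OF cd, of X]
    by simp
  have "(a, d) \<in> conn (insert (b, c) r)"
    using mono[OF ab] mono[OF cd] conn_edge[of b c "insert (b, c) r"] conn_trans by (metis insertI1)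
  then show "Suc (num_classes X (r \<union> {(a, d), (b, c)})) = num_classes X r"
    unfolding eq using num_classes_insert_conn[of a d "insert (b, c) r" X]
      num_classes_insert_not_conn[OF X(1,3,4) bc] by simp
  have "(b, d) \<in> conn (insert (a, c) r)"
    using mono[OF ab] mono[OF cd] conn_edge[of a c "insert (a, c) r"] conn_trans conn_sym by (metis insertI1)
  then show "Suc (num_classes X (r \<union> {(a, c), (b, d)})) = num_classes X r"
    unfolding eq insert_commute[of "(a, c)"] using num_classes_insert_conn[of b d "insert (a, c) r" X]
      num_classes_insert_not_conn[OF X(1,2,4) ac] by simp
qed

text \<open>With the extra edge from \<open>a\<close> to \<open>c\<close>, either splice joins all
  four ends, so the two numbers become equal; and one edge lowers the number by at most 1. The
  argument covers virtual diagrams too, where the numbers may also be equal.\<close>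

lemma num_classes_real_le:
  assumes "finite X" and "set_tile t \<subseteq> X" and "is_real t"
  shows "num_classes X (r \<union> spliced_strands s t) \<le> Suc (num_classes X (r \<union> spliced_strands s' t))"
proof -
  obtain a b c d where t: "t = RealX a b c d" using assms(3) is_real_iff by metis
  let ?r = "\<lambda>s. insert (a, c) (r \<union> spliced_strands s t)"
  have edges: "(x, y) \<in> conn (?r s)" if "(x, y) \<in> insert (a, c) (spliced_strands s t)" for x y s
    using that conn_edge[of x y "?r s"] by blast
  have "(a, b) \<in> conn (?r s) \<and> (c, d) \<in> conn (?r s) \<and> (a, d) \<in> conn (?r s) \<and> (b, c) \<in> conn (?r s)" for s
  proof (cases s)
    case A
    then have "(a, c) \<in> conn (?r s)" "(a, b) \<in> conn (?r s)" "(c, d) \<in> conn (?r s)"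
      using edges[of _ _ s] by (simp_all add: t)
    then show ?thesis using conn_sym conn_trans by metis
  next
    case B
    then have "(a, c) \<in> conn (?r s)" "(a, d) \<in> conn (?r s)" "(b, c) \<in> conn (?r s)"
      using edges[of _ _ s] by (simp_all add: t)
    then show ?thesis using conn_sym conn_trans by metis
  qed
  then have "spliced_strands s' t \<subseteq> conn (?r s)" for s s'
    by (cases s') (auto simp: t)
  moreover have "insert (a, c) r \<subseteq> conn (?r s)" for s by (auto intro: conn_edge)
  ultimately have "num_classes X (?r s) = num_classes X (?r s')"
    by (intro num_classes_cong) auto
  moreover have "a \<in> X" "c \<in> X" using assms(2) by (simp_all add: t)
  ultimately show ?thesis
    using num_classes_insert_bounds(2)[OF assms(1), of a c "r \<union> spliced_strands s t"]
      num_classes_insert_bounds(1)[OF assms(1), of a c "r \<union> spliced_strands s' t"] by simp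
qed

definition state_strands :: "code \<Rightarrow> state \<Rightarrow> (nat \<times> nat) set" where
  "state_strands D s = (\<Union>i<length D. spliced_strands (s i) (D ! i))"

lemma state_strands_Nil [simp]: "state_strands [] s = {}"
  by (simp add: state_strands_def)

lemma state_strands_Cons:
  "state_strands (t # D) s = spliced_strands (s 0) t \<union> state_strands D (s \<circ> Suc)"
  by (simp add: state_strands_def lessThan_Suc_eq_insert_0)

lemma state_strands_Cons_upd:
  "state_strands (t # D) (s(0 := x)) = spliced_strands x t \<union> state_strands D (s \<circ> Suc)"
  "state_strands (t # D) (s(Suc q := x)) = spliced_strands (s 0) t \<union> state_strands D ((s \<circ> Suc)(q := x))"
proof -
  have "s(0 := x) \<circ> Suc = s \<circ> Suc" "s(Suc q := x) \<circ> Suc = (s \<circ> Suc)(q := x)" by auto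
  then show "state_strands (t # D) (s(0 := x)) = spliced_strands x t \<union> state_strands D (s \<circ> Suc)"
    "state_strands (t # D) (s(Suc q := x)) = spliced_strands (s 0) t \<union> state_strands D ((s \<circ> Suc)(q := x))"
    by (simp_all add: state_strands_Cons)
qed

lemma num_components_spliced:
  "num_components (spliced D s) = num_classes (labels D) (state_strands D s)"
proof -
  have set: "set (spliced D s) = (\<Union>i<length D. set (splice_tile (s i) (D ! i)))"
    by (auto simp: spliced_def)
  have "(\<Union>u\<in>set (splice_tile s t). set_tile u) = set_tile t" for s and t :: "nat tile"
    by (cases t; cases s) auto
  then have "labels (spliced D s) = (\<Union>i<length D. set_tile (D ! i))"
    by (simp add: labels_def set)
  also have "\<dots> = labels D"
  proof -
    have "set D = (!) D ` {..<length D}" by (auto simp: set_conv_nth)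
    then show ?thesis by (simp add: labels_def)
  qed
  finally have "labels (spliced D s) = labels D" .
  moreover have "(\<Union>t\<in>set (spliced D s). strands t) = state_strands D s"
    by (simp add: set state_strands_def spliced_strands_def)
  ultimately show ?thesis by (simp add: num_components_def)
qed

lemma state_strands_split:
  assumes "p < length D"
  shows "state_strands D s =
    (\<Union>i\<in>{..<length D} - {p}. spliced_strands (s i) (D ! i)) \<union> spliced_strands (s p) (D ! p)"
  using assms by (auto simp: state_strands_def)

fun other :: "splice \<Rightarrow> splice" where
  "other A = B"
| "other B = A"

definition num_real :: "code \<Rightarrow> nat" where
  "num_real D = length (filter is_real D)"

text \<open>By \<open>crossing_connections\<close> the rest of the state realizes exactly one of the
  two pairings of neighbouring ends. The splice with the same pairing has one circle more than the
  other splice and than the virtual crossing.\<close>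

lemma crossing_counts:
  assumes cl: "classical_diagram D" and p: "p < length D" "D ! p = RealX a b c d"
  defines "G \<equiv> \<lambda>s. \<Union>i\<in>{..<length D} - {p}. spliced_strands (s i) (D ! i)"
    and "k \<equiv> \<lambda>r. num_classes (labels D) r"
  shows "k (G s \<union> {(a, b), (c, d)}) = Suc (k (G s \<union> {(a, d), (b, c)})) \<and>
      k (G s \<union> {(a, c), (b, d)}) = k (G s \<union> {(a, d), (b, c)}) \<or>
    k (G s \<union> {(a, d), (b, c)}) = Suc (k (G s \<union> {(a, b), (c, d)})) \<and>
      k (G s \<union> {(a, c), (b, d)}) = k (G s \<union> {(a, b), (c, d)})"
proof -
  have "set_tile (D ! p) \<subseteq> labels D" using p(1) by (force simp: labels_def)
  then have L: "a \<in> labels D" "b \<in> labels D" "c \<in> labels D" "d \<in> labels D" by (auto simp: p(2))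
  note fin = finite_labels[of D]
  have conn: "(a, c) \<notin> conn (G s) \<and> ((a, b) \<in> conn (G s) \<and> (c, d) \<in> conn (G s) \<or>
      (a, d) \<in> conn (G s) \<and> (b, c) \<in> conn (G s))"
    unfolding G_def by (rule crossing_connections[OF cl p])
  then consider "(a, b) \<in> conn (G s)" "(c, d) \<in> conn (G s)"
    | "(a, d) \<in> conn (G s)" "(c, b) \<in> conn (G s)"
    using conn_sym by metis
  then show ?thesis
  proof cases
    case 1
    from num_classes_crossing[OF fin L 1] conn show ?thesis unfolding k_def by simp
  next
    case 2
    \<comment> \<open>The second case is the first with \<open>b\<close> and \<open>d\<close>
      exchanged; only the direction of some strands has to be restored.\<close>
    have flip: "num_classes X (r \<union> {e, (c, b)}) = num_classes X (r \<union> {e, (b, c)})"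
      "num_classes X (r \<union> {(a, b), (d, c)}) = num_classes X (r \<union> {(a, b), (c, d)})"
      "num_classes X (r \<union> {(a, c), (d, b)}) = num_classes X (r \<union> {(a, c), (b, d)})"
      for X e and r :: "(nat \<times> nat) set"
      by (rule num_classes_sym; auto)+
    from num_classes_crossing[OF fin L(1,4,3,2) 2] conn show ?thesis
      unfolding k_def flip by simp
  qed
qed

section \<open>Virtualizing one crossing\<close>

lemma virtualize_strands:
  assumes "p < length D" and "D ! p = RealX a b c d"
  shows "state_strands (virtualize D p) s =
    (\<Union>i\<in>{..<length D} - {p}. spliced_strands (s i) (D ! i)) \<union> {(a, c), (b, d)}"
  using assms by (subst state_strands_split[of p]) (auto simp: virtualize_def)

lemma labels_virtualize:
  assumes "p < length D" and "D ! p = RealX a b c d"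
  shows "labels (virtualize D p) = labels D"
proof -
  have "D = take p D @ RealX a b c d # drop (Suc p) D" using id_take_nth_drop[OF assms(1)] assms(2) by simp
  then have "labels D = labels (take p D @ RealX a b c d # drop (Suc p) D)" by simp
  then show ?thesis by (simp add: virtualize_def upd_conv_take_nth_drop[OF assms(1)] assms(2))
qed

lemma num_real_virtualize:
  assumes "p < length D" and "D ! p = RealX a b c d"
  shows "num_real D = Suc (num_real (virtualize D p))"
proof -
  have "D = take p D @ RealX a b c d # drop (Suc p) D" using id_take_nth_drop[OF assms(1)] assms(2) by simp
  then have "num_real D = num_real (take p D @ RealX a b c d # drop (Suc p) D)" by simp
  then show ?thesis
    by (simp add: num_real_def virtualize_def upd_conv_take_nth_drop[OF assms(1)] assms(2))
qed

lemma state_counts_ne: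
  assumes "classical_diagram D" and "q < length D" and "is_real (D ! q)"
  shows "num_classes (labels D) (state_strands D (s(q := A))) \<noteq>
    num_classes (labels D) (state_strands D (s(q := B)))"
proof -
  obtain a b c d where q: "D ! q = RealX a b c d" using assms(3) is_real_iff by metis
  have "(\<Union>i\<in>{..<length D} - {q}. spliced_strands ((s(q := x)) i) (D ! i)) =
      (\<Union>i\<in>{..<length D} - {q}. spliced_strands (s i) (D ! i))" for x by auto
  then show ?thesis
    using crossing_counts[OF assms(1,2) q, of s]
    by (simp only: state_strands_split[OF assms(2)] fun_upd_same q spliced_strands_simps) linarith
qed

lemma virtualize_count_le:
  assumes "classical_diagram D" and "p < length D" and "is_real (D ! p)"
  shows "num_classes (labels D) (state_strands (virtualize D p) s) \<le>
    num_classes (labels D) (state_strands D s)"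
proof -
  obtain a b c d where p: "D ! p = RealX a b c d" using assms(3) is_real_iff by metis
  show ?thesis
    using crossing_counts[OF assms(1,2) p, of s]
    by (cases "s p") (auto simp: state_strands_split[OF assms(2)] virtualize_strands[OF assms(2) p] p)
qed

text \<open>If the switch at \<open>p\<close> loses a circle, \<open>s\<close> has the larger of the
  two real counts, and the virtual crossing has the smaller one.\<close>

lemma virtualize_count_Suc:
  assumes "classical_diagram D" and "p < length D" and "is_real (D ! p)"
    and "num_classes (labels D) (state_strands D (s(p := other (s p)))) <
      num_classes (labels D) (state_strands D s)"
  shows "num_classes (labels D) (state_strands D s) =
    Suc (num_classes (labels D) (state_strands (virtualize D p) s))"
proof -
  obtain a b c d where p: "D ! p = RealX a b c d" using assms(3) is_real_iff by metis
  have "(\<Union>i\<in>{..<length D} - {p}. spliced_strands ((s(p := x)) i) (D ! i)) =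
      (\<Union>i\<in>{..<length D} - {p}. spliced_strands (s i) (D ! i))" for x by auto
  then show ?thesis
    using crossing_counts[OF assms(1,2) p, of s] assms(4)
    by (cases "s p") (auto simp: state_strands_split[OF assms(2)] virtualize_strands[OF assms(2) p] p)
qed

section \<open>Exponents of the bracket\<close>

fun exponent :: "splice \<Rightarrow> int" where
  "exponent A = 1"
| "exponent B = - 1"

unbundle fps_syntax

text \<open>The series variable plays the part of the bracket variable A, so \<open>weight B\<close>
  is its inverse.\<close>

definition weight :: "splice \<Rightarrow> int fls" where
  "weight s = fls_X_intpow (exponent s)"

definition loop_value :: "int fls" where
  "loop_value = - (weight A)\<^sup>2 - (weight B)\<^sup>2"

lemma bracket_Nil: "bracket weight X r [] = loop_value ^ num_classes X r"
  by (simp add: loop_value_def)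

lemma weight_times_nth [simp]: "(weight s * f) $$ n = f $$ (n - exponent s)"
  by (simp add: weight_def fls_X_intpow_times_conv_shift)

lemma weight_inverse: "weight A * weight B = 1"
  unfolding weight_def fls_X_intpow_times_fls_X_intpow by simp

lemma loop_value_times_nth: "(loop_value * f) $$ n = - f $$ (n - 2) - f $$ (n + 2)"
  by (simp add: loop_value_def power2_eq_square left_diff_distrib mult.assoc add.commute)

text \<open>By the binomial expansion the exponents run from \<open>2 * m\<close> down to
  \<open>- 2 * m\<close> in steps of 4.\<close>

lemma loop_value_power_nth_nonzero:
  "(loop_value ^ m) $$ n \<noteq> 0 \<Longrightarrow> n mod 4 = int (2 * m) mod 4 \<and> \<bar>n\<bar> \<le> int (2 * m)"
proof (induction m arbitrary: n)
  case (Suc m)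
  then have "(loop_value ^ m) $$ (n - 2) \<noteq> 0 \<or> (loop_value ^ m) $$ (n + 2) \<noteq> 0"
    by (auto simp: loop_value_times_nth)
  then have "((n - 2) mod 4 = int (2 * m) mod 4 \<or> (n + 2) mod 4 = int (2 * m) mod 4) \<and> \<bar>n\<bar> \<le> int (2 * m) + 2"
    using Suc.IH[of "n - 2"] Suc.IH[of "n + 2"] by auto
  moreover have "int (2 * Suc m) = int (2 * m) + 2" by simp
  moreover have "n mod 4 = (k + 2) mod 4" if "(n - 2) mod 4 = k mod 4 \<or> (n + 2) mod 4 = k mod 4" for k :: int
  proof -
    have "4 dvd n - 2 - k" if "4 dvd n + 2 - k" using that by presburger
    then have "4 dvd n - 2 - k" using that by (auto simp: mod_eq_dvd_iff)
    then show ?thesis by (simp add: mod_eq_dvd_iff diff_diff_eq add.commute)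
  qed
  ultimately show ?case by metis
qed (simp split: if_splits)

lemma loop_value_power_nth_top: "(loop_value ^ m) $$ (exponent s * int (2 * m)) = (- 1) ^ m"
proof (induction m)
  case (Suc m)
  let ?e = "exponent s"
  \<comment> \<open>The new extreme coefficient is a sum of two old ones. One is the old extreme
    coefficient, the other lies 4 beyond it and vanishes.\<close>
  have zero: "(loop_value ^ m) $$ (?e * int (2 * m) + 4 * ?e) = 0"
    using loop_value_power_nth_nonzero[of m "?e * int (2 * m) + 4 * ?e"] by (cases s) auto
  show ?case
    using Suc zero by (cases s) (simp_all add: loop_value_times_nth algebra_simps)
qed simp

text \<open>With the splice as a parameter, one argument treats the highest exponent
  (\<open>s = A\<close>) and the lowest one (\<open>s = B\<close>).\<close>

lemma bracket_Cons_real: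
  "is_real t \<Longrightarrow> bracket w X r (t # D) =
    w s * bracket w X (r \<union> spliced_strands s t) D +
    w (other s) * bracket w X (r \<union> spliced_strands (other s) t) D"
  by (cases s) (simp_all add: add.commute)

lemma bracket_Cons_not_real:
  "\<not> is_real t \<Longrightarrow> bracket w X r (t # D) = bracket w X (r \<union> spliced_strands s t) D"
  by (cases t) simp_all

lemma exponent_other [simp]: "exponent (other s) = - exponent s"
  by (cases s) simp_all

text \<open>Measured in the direction of \<open>s\<close>, a switch away from \<open>s\<close> costs
  2 in the weights and gains at most one circle, which is worth 2. No state can exceed the constant
  one.\<close>

lemma bracket_nth_above:
  assumes "finite X" and "labels D \<subseteq> X"
    and "n > int (num_real D + 2 * num_classes X (r \<union> state_strands D (\<lambda>_. s)))"
  shows "bracket weight X r D $$ (exponent s * n) = 0"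
  using assms(2,3)
proof (induction D arbitrary: r n)
  case Nil
  then have "\<not> \<bar>exponent s * n\<bar> \<le> int (2 * num_classes X r)"
    by (cases s) (auto simp: num_real_def)
  then show ?case
    using loop_value_power_nth_nonzero[of "num_classes X r" "exponent s * n"] unfolding bracket_Nil by auto
next
  case (Cons t D)
  let ?r = "\<lambda>s'. r \<union> spliced_strands s' t"
  have D: "labels D \<subseteq> X" "set_tile t \<subseteq> X" using Cons.prems by auto
  have eq: "r \<union> state_strands (t # D) (\<lambda>_. s) = ?r s \<union> state_strands D (\<lambda>_. s)"
    by (simp add: state_strands_Cons o_def Un_assoc)
  show ?case
  proof (cases "is_real t")
    case True
    have "num_classes X (?r (other s) \<union> state_strands D (\<lambda>_. s)) \<le>
        Suc (num_classes X (?r s \<union> state_strands D (\<lambda>_. s)))"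
      using num_classes_real_le[OF assms(1) D(2) True, of "r \<union> state_strands D (\<lambda>_. s)" "other s" s]
      by (simp add: Un_ac)
    then have "bracket weight X (?r s) D $$ (exponent s * (n - 1)) = 0"
      "bracket weight X (?r (other s)) D $$ (exponent s * (n + 1)) = 0"
      using Cons.prems True unfolding eq by (intro Cons.IH D; simp add: num_real_def)+
    then show ?thesis
      by (simp add: bracket_Cons_real[OF True, of _ _ _ _ s] algebra_simps del: bracket.simps)
  next
    case False
    then have "bracket weight X (?r s) D $$ (exponent s * n) = 0"
      using Cons.prems unfolding eq by (intro Cons.IH D) (simp add: num_real_def)
    then show ?thesis by (simp add: bracket_Cons_not_real[OF False, of _ _ _ _ s] del: bracket.simps)
  qed
qed

text \<open>When the first switch gains no circle, its cost of 2 is never made up by later switches,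
  so the constant state alone reaches the extreme exponent. The inequality is not strict because
  this is the form that is derived for a virtualized diagram.\<close>

lemma bracket_nth_top:
  assumes "finite X" and "labels D \<subseteq> X"
    and "\<And>q. q < length D \<Longrightarrow> is_real (D ! q) \<Longrightarrow>
      num_classes X (r \<union> state_strands D ((\<lambda>_. s)(q := other s))) \<le>
      num_classes X (r \<union> state_strands D (\<lambda>_. s))"
  shows "bracket weight X r D $$
      (exponent s * int (num_real D + 2 * num_classes X (r \<union> state_strands D (\<lambda>_. s)))) =
    (- 1) ^ num_classes X (r \<union> state_strands D (\<lambda>_. s))"
  using assms(2,3)
proof (induction D arbitrary: r)
  case Nil
  show ?case
    using loop_value_power_nth_top[of "num_classes X r" s] unfolding bracket_Nil by (simp add: num_real_def)
next
  case (Cons t D)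
  let ?r = "\<lambda>s'. r \<union> spliced_strands s' t"
  have D: "labels D \<subseteq> X" "set_tile t \<subseteq> X" using Cons.prems by auto
  let ?k = "num_classes X (?r s \<union> state_strands D (\<lambda>_. s))"
  have eq: "r \<union> state_strands (t # D) (\<lambda>_. s) = ?r s \<union> state_strands D (\<lambda>_. s)"
    by (simp add: state_strands_Cons o_def Un_assoc)
  have IH: "bracket weight X (?r s) D $$ (exponent s * int (num_real D + 2 * ?k)) = (- 1) ^ ?k"
  proof (rule Cons.IH[OF D(1)])
    fix q assume q: "q < length D" "is_real (D ! q)"
    show "num_classes X (?r s \<union> state_strands D ((\<lambda>_. s)(q := other s))) \<le> ?k"
      using Cons.prems(2)[of "Suc q"] q unfolding eq state_strands_Cons_upd o_def Un_assoc by simp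
  qed
  show ?case
  proof (cases "is_real t")
    case True
    have "num_classes X (?r (other s) \<union> state_strands D (\<lambda>_. s)) \<le> ?k"
      using Cons.prems(2)[of 0] True unfolding eq state_strands_Cons_upd o_def Un_assoc by simp
    then have "bracket weight X (?r (other s)) D $$ (exponent s * (int (num_real D + 2 * ?k) + 2)) = 0"
      by (intro bracket_nth_above assms(1) D) simp
    then show ?thesis
      using IH True unfolding eq
      by (simp add: bracket_Cons_real[OF True, of _ _ _ _ s] num_real_def algebra_simps del: bracket.simps)
  next
    case False
    then show ?thesis
      using IH unfolding eq
      by (simp add: bracket_Cons_not_real[OF False, of _ _ _ _ s] num_real_def del: bracket.simps)
  qed
qed

text \<open>A switch from A to B lowers the exponent of the weights by 2 and, as the number of
  circles changes by exactly one, moves the extreme exponent of the loop factor by 2 up or down. In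
  total this is 0 or -4, and within one state the loop factor has steps of 4.\<close>

lemma bracket_nth_mod_4:
  assumes "finite X" and "labels D \<subseteq> X"
    and "\<And>s q. q < length D \<Longrightarrow> is_real (D ! q) \<Longrightarrow>
      num_classes X (r \<union> state_strands D (s(q := A))) \<noteq> num_classes X (r \<union> state_strands D (s(q := B)))"
    and "bracket weight X r D $$ n \<noteq> 0"
  shows "n mod 4 = int (num_real D + 2 * num_classes X (r \<union> state_strands D (\<lambda>_. A))) mod 4"
  using assms(2-4)
proof (induction D arbitrary: r n)
  case Nil
  then show ?case
    using loop_value_power_nth_nonzero[of "num_classes X r" n] unfolding bracket_Nil by (simp add: num_real_def)
next
  case (Cons t D)
  let ?r = "\<lambda>s'. r \<union> spliced_strands s' t"
  have D: "labels D \<subseteq> X" "set_tile t \<subseteq> X" using Cons.prems by auto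
  let ?k = "\<lambda>s. num_classes X (?r s \<union> state_strands D (\<lambda>_. A))"
  have eq: "r \<union> state_strands (t # D) (\<lambda>_. A) = ?r A \<union> state_strands D (\<lambda>_. A)"
    by (simp add: state_strands_Cons o_def Un_assoc)
  have IH: "n' mod 4 = int (num_real D + 2 * ?k s) mod 4"
    if "bracket weight X (?r s) D $$ n' \<noteq> 0" for n' s
  proof (rule Cons.IH[OF D(1) _ that])
    fix s' q assume q: "q < length D" "is_real (D ! q)"
    \<comment> \<open>The hypothesis on \<open>t # D\<close> is used for the state that takes
      \<open>s\<close> at \<open>t\<close> and \<open>s'\<close> behind it.\<close>
    show "num_classes X (?r s \<union> state_strands D (s'(q := A))) \<noteq>
        num_classes X (?r s \<union> state_strands D (s'(q := B)))"
      using Cons.prems(2)[of "Suc q" "case_nat s s'"] q unfolding state_strands_Cons_upd o_def Un_assoc by simp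
  qed
  show ?case
  proof (cases "is_real t")
    case True
    have "?k A \<noteq> ?k B"
      using Cons.prems(2)[of 0 "\<lambda>_. A"] True unfolding state_strands_Cons_upd o_def Un_assoc by simp
    moreover have le: "?k s \<le> Suc (?k s')" for s s'
      using num_classes_real_le[OF assms(1) D(2) True, of "r \<union> state_strands D (\<lambda>_. A)" s s']
      by (simp add: Un_ac)
    ultimately have k: "?k B = Suc (?k A) \<or> ?k A = Suc (?k B)"
      using le[of A B] le[of B A] by linarith
    from Cons.prems(3) True
    have "bracket weight X (?r A) D $$ (n - 1) \<noteq> 0 \<or> bracket weight X (?r B) D $$ (n + 1) \<noteq> 0"
      by auto
    then have "(n - 1) mod 4 = int (num_real D + 2 * ?k A) mod 4 \<or>
        (n + 1) mod 4 = int (num_real D + 2 * ?k B) mod 4"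
      using IH by blast
    moreover have "num_real (t # D) = Suc (num_real D)" using True by (simp add: num_real_def)
    moreover have "n mod 4 = (x + 1) mod 4"
      if "(n - 1) mod 4 = x mod 4 \<or> (n + 1) mod 4 = y mod 4" "y = x + 2 \<or> y = x - 2" for x y :: int
    proof -
      have "4 dvd n - 1 - x" if "4 dvd n + 1 - y" using that \<open>y = x + 2 \<or> y = x - 2\<close> by presburger
      then have "4 dvd n - 1 - x" using that(1) by (auto simp: mod_eq_dvd_iff)
      then show ?thesis by (simp add: mod_eq_dvd_iff diff_diff_eq add.commute)
    qed
    moreover have "int (num_real D + 2 * ?k B) = int (num_real D + 2 * ?k A) + 2 \<or>
        int (num_real D + 2 * ?k B) = int (num_real D + 2 * ?k A) - 2"
      using k by auto
    moreover have "int (Suc (num_real D) + 2 * ?k A) = int (num_real D + 2 * ?k A) + 1" by simp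
    ultimately show ?thesis unfolding eq by metis
  next
    case False
    then show ?thesis using Cons.prems(3) IH[of A n] unfolding eq by (simp add: num_real_def)
  qed
qed

section \<open>Congruence of exponents as an invariant of virtual links\<close>

definition exponents_congruent :: "int fls \<Rightarrow> bool" where
  "exponents_congruent f \<longleftrightarrow> (\<exists>c. \<forall>n. f $$ n \<noteq> 0 \<longrightarrow> n mod 4 = c)"

text \<open>The residue is left open in the definition and only the vanishing of coefficients
  counts. Multiplication by the unit of a first Reidemeister move is therefore harmless: its sign is
  not seen, and its exponent only changes the residue.\<close>

lemma exponents_congruent_shift:
  assumes "\<And>n. f $$ n = 0 \<longleftrightarrow> g $$ (n - k) = 0"
  shows "exponents_congruent f \<longleftrightarrow> exponents_congruent g"
proof
  assume "exponents_congruent f"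
  then obtain c where "\<And>n. f $$ n \<noteq> 0 \<Longrightarrow> n mod 4 = c" by (auto simp: exponents_congruent_def)
  then have "n mod 4 = (c - k) mod 4" if "g $$ n \<noteq> 0" for n
    using that assms[of "n + k"] by (metis add_diff_cancel_right' mod_diff_left_eq)
  then show "exponents_congruent g" by (auto simp: exponents_congruent_def)
next
  assume "exponents_congruent g"
  then obtain c where "\<And>n. g $$ n \<noteq> 0 \<Longrightarrow> n mod 4 = c" by (auto simp: exponents_congruent_def)
  then have "n mod 4 = (c + k) mod 4" if "f $$ n \<noteq> 0" for n
    using that assms[of n] by (metis diff_add_cancel mod_add_left_eq)
  then show "exponents_congruent f" by (auto simp: exponents_congruent_def)
qed

lemma exponents_congruent_move:
  assumes "move D E"
  shows "exponents_congruent (kauffman_bracket weight D) \<longleftrightarrow>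
    exponents_congruent (kauffman_bracket weight E)"
proof -
  have cube: "(- (weight s ^ 3) * f) $$ n = - (f $$ (n - 3 * exponent s))" for s f n
    by (simp add: power3_eq_cube mult.assoc)
  obtain u where "u \<in> {1, - (weight A ^ 3), - (weight B ^ 3)}"
    "kauffman_bracket weight D = u * kauffman_bracket weight E"
    using kauffman_bracket_move[OF assms weight_inverse] by blast
  then consider "kauffman_bracket weight D = kauffman_bracket weight E"
    | s where "kauffman_bracket weight D = - (weight s ^ 3) * kauffman_bracket weight E"
    by (metis empty_iff insert_iff mult_1)
  then show ?thesis
  proof cases
    case 2
    then show ?thesis
      by (intro exponents_congruent_shift[of _ _ "3 * exponent s"]) (simp only: cube neg_equal_0_iff_equal)
  qed simp
qed

lemma exponents_congruent_equivalent:
  assumes "equivalent D E"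
  shows "exponents_congruent (kauffman_bracket weight D) \<longleftrightarrow>
    exponents_congruent (kauffman_bracket weight E)"
  using assms unfolding equivalent_def
  by (induction rule: equivclp_induct) (use exponents_congruent_move in blast)+

lemma classical_exponents_congruent:
  assumes "classical_diagram D"
  shows "exponents_congruent (kauffman_bracket weight D)"
  unfolding exponents_congruent_def kauffman_bracket_def
  using bracket_nth_mod_4[OF finite_labels subset_refl, of D "{}"] state_counts_ne[OF assms] by simp

theorem corollary4p4:
  fixes D D' :: code
  assumes "classical_diagram D'"
    and "v_adequate_from D' D"
  shows "\<not> represents_classical_link D"
proof
  assume "represents_classical_link D"
  then obtain E where "classical_diagram E" "equivalent D E"
    by (auto simp: represents_classical_link_def)
  then have congruent: "exponents_congruent (kauffman_bracket weight D)"
    using exponents_congruent_equivalent classical_exponents_congruent by blast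
  have congruent': "exponents_congruent (kauffman_bracket weight D')"
    by (rule classical_exponents_congruent[OF assms(1)])
  obtain p where p: "p \<in> real_crossings D'" and D: "D = virtualize D' p" and ad: "adequate D'"
    using assms(2) by (auto simp: v_adequate_from_def)
  have real: "q \<in> real_crossings D' \<longleftrightarrow> q < length D' \<and> is_real (D' ! q)" for q
    by (simp add: real_crossings_def is_real_iff)
  obtain a b c d where p_tile: "p < length D'" "D' ! p = RealX a b c d"
    using p by (auto simp: real_crossings_def)
  let ?k = "\<lambda>s. num_classes (labels D') (state_strands D' (\<lambda>_. s))"
  let ?v = "\<lambda>s. num_classes (labels D') (state_strands D (\<lambda>_. s))"
  have switch: "num_classes (labels D') (state_strands D' ((\<lambda>_. s)(q := other s))) < ?k s"
    if "q < length D'" "is_real (D' ! q)" for q s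
  proof -
    have "q \<in> real_crossings D'" using that real by blast
    then show ?thesis
      using bspec[OF ad[unfolded adequate_def num_components_spliced state_A_def state_B_def]]
      by (cases s) simp_all
  qed
  \<comment> \<open>Adequacy at \<open>p\<close> says that both constant states use the splice with
    more circles there, so either of them loses one circle when \<open>p\<close> becomes
    virtual.\<close>
  have k: "?k s = Suc (?v s)" for s
    unfolding D using p switch[of p s] by (intro virtualize_count_Suc[OF assms(1)]) (simp_all add: real)
  have labels: "labels D = labels D'" unfolding D by (rule labels_virtualize[OF p_tile])
  have n: "num_real D' = Suc (num_real D)" unfolding D by (rule num_real_virtualize[OF p_tile])
  have extreme': "kauffman_bracket weight D' $$ (exponent s * int (num_real D' + 2 * ?k s)) \<noteq> 0" for s
    using bracket_nth_top[OF finite_labels subset_refl, of D' "{}" s] switch[of _ s]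
    by (simp add: kauffman_bracket_def less_imp_le)
  have extreme: "kauffman_bracket weight D $$ (exponent s * int (num_real D + 2 * ?v s)) \<noteq> 0" for s
  proof -
    \<comment> \<open>Virtualizing does not raise the count of the switched state, which by adequacy
      of \<open>D'\<close> is at most \<open>?k s - 1\<close>, that is \<open>?v s\<close>.\<close>
    have "num_classes (labels D') (state_strands D ((\<lambda>_. s)(q := other s))) \<le> ?v s"
      if q: "q < length D" "is_real (D ! q)" for q
    proof -
      have "q \<noteq> p" using q p_tile by (auto simp: D virtualize_def)
      then have "q < length D'" "is_real (D' ! q)" using q by (simp_all add: D virtualize_def)
      then have "num_classes (labels D') (state_strands D' ((\<lambda>_. s)(q := other s))) < ?k s"
        by (rule switch)
      moreover have "num_classes (labels D') (state_strands D ((\<lambda>_. s)(q := other s))) \<le>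
          num_classes (labels D') (state_strands D' ((\<lambda>_. s)(q := other s)))"
        unfolding D using p by (intro virtualize_count_le[OF assms(1)]) (simp_all add: real)
      ultimately show ?thesis using k[of s] by simp
    qed
    then show ?thesis
      using bracket_nth_top[OF finite_labels subset_refl, of D "{}" s]
      by (simp add: kauffman_bracket_def labels)
  qed
  have "int (num_real D + 2 * ?v A) mod 4 = - int (num_real D + 2 * ?v B) mod 4"
    using congruent extreme[of A] extreme[of B] unfolding exponents_congruent_def
    by (metis exponent.simps mult_1 mult_minus1)
  then have "4 dvd int (num_real D + 2 * ?v A) + int (num_real D + 2 * ?v B)" (is "4 dvd ?span")
    by (simp only: mod_eq_dvd_iff diff_minus_eq_add)
  moreover have "int (num_real D' + 2 * ?k A) mod 4 = - int (num_real D' + 2 * ?k B) mod 4"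
    using congruent' extreme'[of A] extreme'[of B] unfolding exponents_congruent_def
    by (metis exponent.simps mult_1 mult_minus1)
  then have "4 dvd int (num_real D' + 2 * ?k A) + int (num_real D' + 2 * ?k B)"
    by (simp only: mod_eq_dvd_iff diff_minus_eq_add)
  \<comment> \<open>The crossing lost is counted once at each end, which gives 2, and the circle
    lost at each end is weighted by 2, which gives 4.\<close>
  then have "4 dvd ?span + 6" by (simp add: n k algebra_simps)
  ultimately have "4 dvd (6 :: int)" by (simp only: dvd_add_right_iff)
  then show False by simp
qed

end
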